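(* Let $N\ge 0$ be an integer and fix $\pi^*\in\mathcal P(\mathbb X)$. Consider the POMDP, the finite-window belief-MDP with optimal value function $J^*_\beta:\hat{\mathcal Z}\to\mathbb R$, and the approximate finite model (in which the first coordinate is replaced by $\pi^*$), all as defined in the context. Let $\phi^N$ be an optimal policy of the approximate model, let $\tilde\phi^N:\hat{\mathcal Z}\to\mathbb U$ be its extension, and let $J_\beta(\cdot,\tilde\phi^N)$ be the value function of $\tilde\phi^N$ in the (true) finite-window belief-MDP. Let $\hat z_0=(\pi_0^-,I_0^N)$, where $\pi_0^-\in\mathcal P(\mathbb X)$ is the prior of $X_0$ and a policy $\hat\gamma$ acts on the first $N$ steps, producing $I_0^N=(Y_{[0,N]},U_{[0,N-1]})$. Then $$E^{\hat\gamma}_{\pi_0^-}\Big[\big|J_\beta(\hat z_0,\tilde\phi^N)-J^*_\beta(\hat z_0)\big|\ \Big|\ I_0^N\Big]\le \frac{2\|c\|_\infty}{1-\beta}\sum_{t=0}^\infty \beta^t L_t ,$$ where $$L_t=\sup_{\hat\gamma\in\hat\Gamma}E_{\pi_0^-}^{\hat\gamma}\Big[\big\|P^{\pi_t^-}(X_{t+N}\in\cdot\,|\,Y_{[t,t+N]},U_{[t,t+N-1]})-P^{\pi^*}(X_{t+N}\in\cdot\,|\,Y_{[t,t+N]},U_{[t,t+N-1]})\big\|_{TV}\Big].$$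
   Context: POMDP: $\mathbb X\subset\mathbb R^m$ is a Borel set (state space), $\mathbb Y$ and $\mathbb U$ are finite sets (observations, actions), $\mathcal T(dx'|x,u)$ is a stochastic kernel from $\mathbb X\times\mathbb U$ to $\mathbb X$, $O(y|x)$ a stochastic kernel from $\mathbb X$ to $\mathbb Y$, $c:\mathbb X\times\mathbb U\to\mathbb R$ is bounded measurable, $\beta\in(0,1)$. Dynamics: $X_0\sim\pi_0^-$, $X_{t+1}\sim\mathcal T(\cdot|X_t,U_t)$, $Y_t\sim O(\cdot|X_t)$. $\mathcal P(\mathbb X)$ is the set of Borel probability measures, and $\|\mu-\nu\|_{TV}=\sup_{\|f\|_\infty\le1}|\int f\,d\mu-\int f\,d\nu|$. Conditional laws: for $\pi\in\mathcal P(\mathbb X)$, $P^{\pi}$ denotes conditional laws when the state at the beginning of the window has prior $\pi$. Explicitly, let $B(\pi,y)(A)=\int_A O(y|x)\pi(dx)/\int O(y|x)\pi(dx)$ (equal to an arbitrary fixed probability measure if the denominator is $0$). Then $P^\pi(X_0\in\cdot|y_0)=B(\pi,y_0)$; $P^\pi(X_{k+1}\in\cdot|y_{[0,k+1]},u_{[0,k]})=B\big(\int\mathcal T(\cdot|x,u_k)P^\pi(dx|y_{[0,k]},u_{[0,k-1]}),\,y_{k+1}\big)$; and $P^\pi(y_{k+1}|y_{[0,k]},u_{[0,k]})=\int\int O(y_{k+1}|x')\mathcal T(dx'|x,u_k)P^\pi(dx|y_{[0,k]},u_{[0,k-1]})$. In $P^{\pi}(X_{t+N}\in\cdot|Y_{[t,t+N]},U_{[t,t+N-1]})$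 the prior $\pi$ is that of $X_t$, i.e. the same formulas are used with time shifted by $t$. Set $G(\pi,y,u)=\int\mathcal T(\cdot|x,u)B(\pi,y)(dx)$. The predictor process is $\pi_{t+1}^-=G(\pi_t^-,Y_t,U_t)$, i.e. the conditional law of $X_{t+1}$ given $Y_{[0,t]},U_{[0,t]}$. Finite-window belief-MDP: state space $\hat{\mathcal Z}=\mathcal P(\mathbb X)\times\mathbb Y^{N+1}\times\mathbb U^N$, with states $\hat z_t=(\pi_t^-,Y_{[t,t+N]},U_{[t,t+N-1]})$ and action $U_{t+N}$; cost $\hat c(\pi,y_{[0,N]},u_{[0,N-1]},u)=\int c(x,u)P^\pi(X_N\in dx|y_{[0,N]},u_{[0,N-1]})$. Its optimal discounted value function $J^*_\beta$ is the bounded solution of $$J^*_\beta(\pi,y_{[0,N]},u_{[0,N-1]})=\min_{u_N\in\mathbb U}\Big(\hat c(\pi,y_{[0,N]},u_{[0,N-1]},u_N)+\beta\sum_{y_{N+1}\in\mathbb Y}J^*_\beta\big(G(\pi,y_0,u_0),y_{[1,N+1]},u_{[1,N]}\big)P^\pi(y_{N+1}|y_{[0,N]},u_{[0,N]})\Big).$$ For a map $\hat\phi:\hat{\mathcal Z}\to\mathbb U$, $J_\beta(\cdot,\hat\phi)$ is the bounded solution of the same equation with the minimum removed and $u_N=\hat\phi(\pi,y_{[0,N]},u_{[0,N-1]})$ (and $J^*_\beta$ replaced by $J_\beta(\cdot,\hat\phi)$ on both sides). Approximate model: finite state space $\{\pi^*\}\times\mathbb Y^{N+1}\times\mathbb U^N$,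 with value function $J^N_\beta$ solving $$J^N_\beta(\pi^*,y_{[0,N]},u_{[0,N-1]})=\min_{u_N\in\mathbb U}\Big(\hat c(\pi^*,y_{[0,N]},u_{[0,N-1]},u_N)+\beta\sum_{y_{N+1}\in\mathbb Y}J^N_\beta(\pi^*,y_{[1,N+1]},u_{[1,N]})P^{\pi^*}(y_{N+1}|y_{[0,N]},u_{[0,N]})\Big).$$ An optimal policy $\phi^N$ is a selector attaining this minimum at every state; it is extended to $\hat{\mathcal Z}$ by $\tilde\phi^N(\pi,y_{[0,N]},u_{[0,N-1]})=\phi^N(\pi^*,y_{[0,N]},u_{[0,N-1]})$. Policies: $\hat\Gamma$ is the set of policies which choose the first $N$ actions $U_0,\dots,U_{N-1}$ as functions of the history of observations and actions available at that time, and afterwards choose $U_{t+N}$ ($t\ge0$) as a measurable function of $(\hat z_0,\dots,\hat z_t)$. $E^{\hat\gamma}_{\pi_0^-}$ is expectation under the true dynamics with $X_0\sim\pi_0^-$ and policy $\hat\gamma$.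
   Formalization: The expectation on the left is taken over the random realizations of I_0^N produced by the policy from the prior, not conditionally on I_0^N; the bound conditional on each realization of I_0^N is false in general. *)

theory Defs
  imports "HOL-Probability.Probability"
begin

text \<open>
  The observation and action sets are the finite types \<open>'y\<close> and \<open>'u\<close>.  A window
  \<open>y_[0,k]\<close>, \<open>u_[0,k-1]\<close> is a pair of lists of lengths \<open>k + 1\<close> and \<open>k\<close>.
\<close>

record ('x, 'y, 'u) pomdp =
  states :: "'x set"
  transition :: "'x \<Rightarrow> 'u \<Rightarrow> 'x measure"
  observation :: "'x \<Rightarrow> 'y measure"
  cost :: "'x \<Rightarrow> 'u \<Rightarrow> real"
  discount :: real
  null_posterior :: "'x measure"
    \<comment> \<open>the fixed posterior used after an observation of probability zero\<close>

definition state_space :: "('x::topological_space, 'y, 'u) pomdp \<Rightarrow> 'x measure" where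
  "state_space P = restrict_space borel (states P)"

definition beliefs :: "('x::topological_space, 'y, 'u) pomdp \<Rightarrow> 'x measure set" where
  "beliefs P = space (prob_algebra (state_space P))"

definition valid_pomdp :: "('x::topological_space, 'y::finite, 'u::finite) pomdp \<Rightarrow> bool" where
  "valid_pomdp P \<longleftrightarrow>
     states P \<in> sets borel \<and>
     (\<lambda>(x, u). transition P x u)
       \<in> state_space P \<Otimes>\<^sub>M count_space UNIV \<rightarrow>\<^sub>M prob_algebra (state_space P) \<and>
     observation P \<in> state_space P \<rightarrow>\<^sub>M prob_algebra (count_space UNIV) \<and>
     (\<lambda>(x, u). cost P x u) \<in> borel_measurable (state_space P \<Otimes>\<^sub>M count_space UNIV) \<and>
     (\<exists>C. \<forall>x\<in>states P. \<forall>u. \<bar>cost P x u\<bar> \<le> C) \<and>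
     0 < discount P \<and> discount P < 1 \<and>
     null_posterior P \<in> beliefs P"

definition cost_norm :: "('x, 'y, 'u) pomdp \<Rightarrow> real" where
  "cost_norm P = (SUP (x, u)\<in>states P \<times> UNIV. \<bar>cost P x u\<bar>)"

text \<open>Total variation without the factor one half, so with values in \<open>[0, 2]\<close>.\<close>

definition tv_dist :: "'x measure \<Rightarrow> 'x measure \<Rightarrow> 'x measure \<Rightarrow> real" where
  "tv_dist S \<mu> \<nu> =
     (SUP f\<in>{f \<in> borel_measurable S. \<forall>x\<in>space S. \<bar>f x\<bar> \<le> 1}.
        \<bar>(\<integral>x. f x \<partial>\<mu>) - (\<integral>x. f x \<partial>\<nu>)\<bar>)"

definition obs_prob :: "('x, 'y, 'u) pomdp \<Rightarrow> 'y \<Rightarrow> 'x \<Rightarrow> real" where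
  "obs_prob P y x = measure (observation P x) {y}"

definition bayes :: "('x, 'y, 'u) pomdp \<Rightarrow> 'x measure \<Rightarrow> 'y \<Rightarrow> 'x measure" where
  "bayes P \<pi> y =
     (let d = (\<integral>x. obs_prob P y x \<partial>\<pi>)
      in if d = 0 then null_posterior P else density \<pi> (\<lambda>x. ennreal (obs_prob P y x / d)))"

definition propagate :: "('x, 'y, 'u) pomdp \<Rightarrow> 'x measure \<Rightarrow> 'u \<Rightarrow> 'x measure" where
  "propagate P \<mu> u = \<mu> \<bind> (\<lambda>x. transition P x u)"

definition next_predictor :: "('x, 'y, 'u) pomdp \<Rightarrow> 'x measure \<Rightarrow> 'y \<Rightarrow> 'u \<Rightarrow> 'x measure" where
  "next_predictor P \<pi> y u = propagate P (bayes P \<pi> y) u"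

primrec filter_seq ::
  "('x, 'y, 'u) pomdp \<Rightarrow> 'x measure \<Rightarrow> (nat \<Rightarrow> 'y) \<Rightarrow> (nat \<Rightarrow> 'u) \<Rightarrow> nat \<Rightarrow> 'x measure" where
  "filter_seq P \<pi> y u 0 = bayes P \<pi> (y 0)"
| "filter_seq P \<pi> y u (Suc k) = bayes P (propagate P (filter_seq P \<pi> y u k) (u k)) (y (Suc k))"

text \<open>\<open>posterior P \<pi> ys us\<close> is the law of the state at the end of the window
  \<open>(ys, us)\<close> when \<open>\<pi>\<close> is the prior of the state at its beginning.\<close>

definition posterior ::
  "('x, 'y, 'u) pomdp \<Rightarrow> 'x measure \<Rightarrow> 'y list \<Rightarrow> 'u list \<Rightarrow> 'x measure" where
  "posterior P \<pi> ys us = filter_seq P \<pi> ((!) ys) ((!) us) (length us)"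

definition next_obs_prob ::
  "('x, 'y, 'u) pomdp \<Rightarrow> 'x measure \<Rightarrow> 'y list \<Rightarrow> 'u list \<Rightarrow> 'u \<Rightarrow> 'y \<Rightarrow> real" where
  "next_obs_prob P \<pi> ys us u y =
     (\<integral>x. (\<integral>x'. obs_prob P y x' \<partial>transition P x u) \<partial>posterior P \<pi> ys us)"

primrec predictor ::
  "('x, 'y, 'u) pomdp \<Rightarrow> 'x measure \<Rightarrow> 'y list \<Rightarrow> 'u list \<Rightarrow> nat \<Rightarrow> 'x measure" where
  "predictor P \<pi> ys us 0 = \<pi>"
| "predictor P \<pi> ys us (Suc t) = next_predictor P (predictor P \<pi> ys us t) (ys ! t) (us ! t)"


type_synonym ('x, 'y, 'u) zhat = "'x measure \<times> 'y list \<times> 'u list"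

definition zhat_space ::
  "('x::topological_space, 'y, 'u) pomdp \<Rightarrow> nat \<Rightarrow> ('x, 'y, 'u) zhat measure" where
  "zhat_space P N =
     prob_algebra (state_space P) \<Otimes>\<^sub>M
       (count_space {ys. length ys = Suc N} \<Otimes>\<^sub>M count_space {us. length us = N})"

definition zhat_at ::
  "('x, 'y, 'u) pomdp \<Rightarrow> nat \<Rightarrow> 'x measure \<Rightarrow> 'y list \<Rightarrow> 'u list \<Rightarrow> nat \<Rightarrow> ('x, 'y, 'u) zhat" where
  "zhat_at P N \<pi>\<^sub>0 ys us t =
     (predictor P \<pi>\<^sub>0 ys us t, take (Suc N) (drop t ys), take N (drop t us))"

definition zcost :: "('x, 'y, 'u) pomdp \<Rightarrow> ('x, 'y, 'u) zhat \<Rightarrow> 'u \<Rightarrow> real" where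
  "zcost P = (\<lambda>(\<pi>, ys, us) u. (\<integral>x. cost P x u \<partial>posterior P \<pi> ys us))"

text \<open>
  Right-hand sides of the two Bellman equations before minimisation.  With
  \<open>us' = us @ [u] = u_[0,N]\<close>, the action \<open>u_0\<close> is \<open>hd us'\<close>; for \<open>N = 0\<close> it is \<open>u\<close> itself.
\<close>

definition bellman ::
  "('x, 'y::finite, 'u) pomdp \<Rightarrow> (('x, 'y, 'u) zhat \<Rightarrow> real) \<Rightarrow> ('x, 'y, 'u) zhat \<Rightarrow> 'u \<Rightarrow> real" where
  "bellman P J = (\<lambda>(\<pi>, ys, us) u.
     zcost P (\<pi>, ys, us) u +
     discount P *
       (\<Sum>y\<in>UNIV. J (next_predictor P \<pi> (hd ys) (hd (us @ [u])), tl (ys @ [y]), tl (us @ [u]))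
                 * next_obs_prob P \<pi> ys us u y))"

definition approx_bellman ::
  "('x, 'y::finite, 'u) pomdp \<Rightarrow> (('x, 'y, 'u) zhat \<Rightarrow> real) \<Rightarrow> ('x, 'y, 'u) zhat \<Rightarrow> 'u \<Rightarrow> real" where
  "approx_bellman P J = (\<lambda>(\<pi>, ys, us) u.
     zcost P (\<pi>, ys, us) u +
     discount P *
       (\<Sum>y\<in>UNIV. J (\<pi>, tl (ys @ [y]), tl (us @ [u])) * next_obs_prob P \<pi> ys us u y))"

definition bounded_on_zhat ::
  "('x::topological_space, 'y, 'u) pomdp \<Rightarrow> nat \<Rightarrow> (('x, 'y, 'u) zhat \<Rightarrow> real) \<Rightarrow> bool" where
  "bounded_on_zhat P N J \<longleftrightarrow> (\<exists>C. \<forall>z\<in>space (zhat_space P N). \<bar>J z\<bar> \<le> C)"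

definition optimal_value ::
  "('x::topological_space, 'y::finite, 'u::finite) pomdp \<Rightarrow> nat
     \<Rightarrow> (('x, 'y, 'u) zhat \<Rightarrow> real) \<Rightarrow> bool" where
  "optimal_value P N J \<longleftrightarrow>
     bounded_on_zhat P N J \<and> (\<forall>z\<in>space (zhat_space P N). J z = (MIN u. bellman P J z u))"

definition policy_value ::
  "('x::topological_space, 'y::finite, 'u::finite) pomdp \<Rightarrow> nat
     \<Rightarrow> (('x, 'y, 'u) zhat \<Rightarrow> 'u) \<Rightarrow> (('x, 'y, 'u) zhat \<Rightarrow> real) \<Rightarrow> bool" where
  "policy_value P N \<phi> J \<longleftrightarrow>
     bounded_on_zhat P N J \<and> (\<forall>z\<in>space (zhat_space P N). J z = bellman P J z (\<phi> z))"

definition approx_states :: "nat \<Rightarrow> 'x measure \<Rightarrow> ('x, 'y, 'u) zhat set" where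
  "approx_states N \<pi>s = {\<pi>s} \<times> {ys. length ys = Suc N} \<times> {us. length us = N}"

definition approx_value ::
  "('x, 'y::finite, 'u::finite) pomdp \<Rightarrow> nat \<Rightarrow> 'x measure
     \<Rightarrow> (('x, 'y, 'u) zhat \<Rightarrow> real) \<Rightarrow> bool" where
  "approx_value P N \<pi>s J \<longleftrightarrow> (\<forall>z\<in>approx_states N \<pi>s. J z = (MIN u. approx_bellman P J z u))"

definition approx_optimal_policy ::
  "('x, 'y::finite, 'u::finite) pomdp \<Rightarrow> nat \<Rightarrow> 'x measure
     \<Rightarrow> (('x, 'y, 'u) zhat \<Rightarrow> real) \<Rightarrow> (('x, 'y, 'u) zhat \<Rightarrow> 'u) \<Rightarrow> bool" where
  "approx_optimal_policy P N \<pi>s J \<phi> \<longleftrightarrow>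
     (\<forall>z\<in>approx_states N \<pi>s. approx_bellman P J z (\<phi> z) = (MIN u. approx_bellman P J z u))"

definition extend_policy ::
  "'x measure \<Rightarrow> (('x, 'y, 'u) zhat \<Rightarrow> 'u) \<Rightarrow> ('x, 'y, 'u) zhat \<Rightarrow> 'u" where
  "extend_policy \<pi>s \<phi> = (\<lambda>(\<pi>, ys, us). \<phi> (\<pi>s, ys, us))"


text \<open>
  A policy is a pair: the first component gives \<open>U_0, ..., U_{N-1}\<close> from the history of
  observations and actions, the second gives \<open>U_{t+N}\<close> from \<open>t\<close> and the sequence
  \<open>z_0, ..., z_t\<close> of states of the finite-window belief-MDP.
\<close>

type_synonym ('x, 'y, 'u) policy =
  "('y list \<Rightarrow> 'u list \<Rightarrow> 'u) \<times> (nat \<Rightarrow> (nat \<Rightarrow> ('x, 'y, 'u) zhat) \<Rightarrow> 'u)"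

definition policies ::
  "('x::topological_space, 'y, 'u) pomdp \<Rightarrow> nat \<Rightarrow> ('x, 'y, 'u) policy set" where
  "policies P N =
     {\<gamma>. \<forall>t. snd \<gamma> t \<in> (\<Pi>\<^sub>M i\<in>{..t}. zhat_space P N) \<rightarrow>\<^sub>M count_space UNIV}"

definition action ::
  "('x, 'y, 'u) pomdp \<Rightarrow> nat \<Rightarrow> 'x measure \<Rightarrow> ('x, 'y, 'u) policy \<Rightarrow> nat
     \<Rightarrow> 'y list \<Rightarrow> 'u list \<Rightarrow> 'u" where
  "action P N \<pi>\<^sub>0 \<gamma> n ys us =
     (if n < N then fst \<gamma> ys us
      else snd \<gamma> (n - N) (\<lambda>i\<in>{..n - N}. zhat_at P N \<pi>\<^sub>0 ys us i))"

text \<open>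
  \<open>law P N \<pi>\<^sub>0 \<gamma> n\<close> is the joint law of \<open>(X_n, Y_[0,n], U_[0,n-1])\<close> under the true dynamics
  with \<open>X_0\<close> distributed as \<open>\<pi>\<^sub>0\<close> and actions chosen by \<open>\<gamma>\<close>.
\<close>

primrec law ::
  "('x::topological_space, 'y, 'u) pomdp \<Rightarrow> nat \<Rightarrow> 'x measure \<Rightarrow> ('x, 'y, 'u) policy
     \<Rightarrow> nat \<Rightarrow> ('x \<times> 'y list \<times> 'u list) measure" where
  "law P N \<pi>\<^sub>0 \<gamma> 0 =
     do {
       x \<leftarrow> \<pi>\<^sub>0;
       y \<leftarrow> observation P x;
       return (state_space P \<Otimes>\<^sub>M count_space UNIV) (x, [y], [])
     }"
| "law P N \<pi>\<^sub>0 \<gamma> (Suc n) =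
     do {
       (x, ys, us) \<leftarrow> law P N \<pi>\<^sub>0 \<gamma> n;
       let u = action P N \<pi>\<^sub>0 \<gamma> n ys us;
       x' \<leftarrow> transition P x u;
       y' \<leftarrow> observation P x';
       return (state_space P \<Otimes>\<^sub>M count_space UNIV) (x', ys @ [y'], us @ [u])
     }"

text \<open>
  Integrating a function of \<open>(\<pi>\<^sub>0, ys, us)\<close> against \<open>law P N \<pi>\<^sub>0 \<gamma> N\<close> averages it over the
  realisations of the initial window \<open>I_0^N = (Y_[0,N], U_[0,N-1])\<close>.
\<close>

definition filter_mismatch ::
  "('x::topological_space, 'y, 'u) pomdp \<Rightarrow> 'x measure \<Rightarrow> ('x, 'y, 'u) zhat \<Rightarrow> real" where
  "filter_mismatch P \<pi>s =
     (\<lambda>(\<pi>, ys, us). tv_dist (state_space P) (posterior P \<pi> ys us) (posterior P \<pi>s ys us))"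

definition L_term ::
  "('x::topological_space, 'y, 'u) pomdp \<Rightarrow> nat \<Rightarrow> 'x measure \<Rightarrow> 'x measure \<Rightarrow> nat \<Rightarrow> real" where
  "L_term P N \<pi>s \<pi>\<^sub>0 t =
     (SUP \<gamma>\<in>policies P N.
        (\<integral>(x, ys, us). filter_mismatch P \<pi>s (zhat_at P N \<pi>\<^sub>0 ys us t) \<partial>law P N \<pi>\<^sub>0 \<gamma> (t + N)))"

end

theory Submission imports Defs begin

text \<open>
  Write \<open>w\<close> for a window and \<open>K = \<parallel>c\<parallel> / (1 - \<beta>)\<close>.  Both \<open>J\<^sup>*\<close> and \<open>J(\<cdot>, \<phi>)\<close> are compared with
  \<open>(\<pi>, w) \<mapsto> J\<^sup>N(\<pi>\<^sup>*, w)\<close>.  Subtracting the Bellman equations, the change of prior in the cost and in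
  the law of the next observation costs at most \<open>K\<close> times the filter mismatch because
  \<open>\<bar>J\<^sup>N\<bar> \<le> K\<close>; what remains is \<open>\<beta>\<close> times the expected gap at the next state under a suitable
  action.  Iterating this along the policy that plays these actions bounds the
  expected gap by \<open>K\<close> times the discounted sum of the \<open>L\<close>-terms, and the two
  comparisons together give the factor 2.

  The actions need no measurable selection theorem: observations and actions are finite, so only
  finitely many states of the belief-MDP are reachable from \<open>\<pi>\<^sub>0\<close> at each time, and on finitely many
  points any choice of actions agrees with a measurable one.
\<close>

section \<open>Finite observation sets, measurable interpolation and minima\<close>

lemma nn_integral_finite_count_space:
  fixes M :: "'a::finite measure"
  assumes "sets M = UNIV"
  shows "(\<integral>\<^sup>+y. f y \<partial>M) = (\<Sum>y\<in>UNIV. f y * emeasure M {y})"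
proof -
  have "space M = UNIV"
    using assms sets_eq_imp_space_eq[of M "count_space UNIV"] by simp
  then have ae: "(\<integral>\<^sup>+y. f y \<partial>M) = (\<integral>\<^sup>+y. (\<Sum>z\<in>UNIV. f z * indicator {z} y) \<partial>M)"
    by (intro nn_integral_cong) (simp add: indicator_def if_distrib cong: if_cong)
  also have "\<dots> = (\<Sum>z\<in>UNIV. \<integral>\<^sup>+y. f z * indicator {z} y \<partial>M)"
    using assms by (intro nn_integral_sum borel_measurable_times_ennreal borel_measurable_indicator) simp_all
  also have "\<dots> = (\<Sum>z\<in>UNIV. f z * emeasure M {z})"
    using assms by (intro sum.cong refl nn_integral_cmult_indicator) simp
  finally show ?thesis .
qed

lemma finite_lists_length: "finite {xs :: 'a::finite list. length xs = n}"
  using finite_lists_length_eq[of "UNIV :: 'a set" n] by simp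

text \<open>A finite intersection of separating sets isolates one point from the finitely many
  others, and the function is redefined on that set. Separation of points is the hypothesis, rather
  than measurability of singletons, because it is easy to verify for a space of probability
  measures.\<close>

lemma exists_measurable_eq_on_finite:
  assumes "finite F" "F \<subseteq> space M"
    and separated: "\<And>z z'. z \<in> space M \<Longrightarrow> z' \<in> space M \<Longrightarrow> z \<noteq> z' \<Longrightarrow> \<exists>A\<in>sets M. z \<in> A \<and> z' \<notin> A"
  shows "\<exists>g\<in>M \<rightarrow>\<^sub>M count_space UNIV. \<forall>z\<in>F. g z = f z"
  using assms(1,2)
proof (induction F rule: finite_induct)
  case empty
  have "(\<lambda>_. undefined) \<in> M \<rightarrow>\<^sub>M count_space UNIV"
    by simp
  then show ?case
    by blast
next
  case (insert z F)
  then obtain g where g [measurable]: "g \<in> M \<rightarrow>\<^sub>M count_space UNIV" and g_eq: "\<forall>z\<in>F. g z = f z"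
    by auto
  have "\<forall>z'\<in>F. \<exists>A\<in>sets M. z \<in> A \<and> z' \<notin> A"
    using insert.prems insert.hyps separated by (metis insert_subset subsetD)
  then obtain A where A: "\<And>z'. z' \<in> F \<Longrightarrow> A z' \<in> sets M \<and> z \<in> A z' \<and> z' \<notin> A z'"
    by metis
  \<comment> \<open>For \<open>F = {}\<close> the intersection is \<open>UNIV\<close>; cutting with
    \<open>space M\<close> keeps \<open>B\<close> measurable.\<close>
  define B where "B = space M \<inter> (\<Inter>z'\<in>F. A z')"
  have B: "B \<in> sets M"
  proof (cases "F = {}")
    case False
    have "(\<Inter>z'\<in>F. A z') \<in> sets M"
      using A insert.hyps False by (intro sets.finite_INT) auto
    then show ?thesis
      by (auto simp: B_def)
  qed (simp add: B_def)
  have zB: "z \<in> B" "\<forall>z'\<in>F. z' \<notin> B"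
    using A insert.prems by (auto simp: B_def)
  have "(\<lambda>x. if x \<in> B then f z else g x) \<in> M \<rightarrow>\<^sub>M count_space UNIV"
    using B by measurable
  then show ?case
    by (rule bexI[rotated]) (use zB g_eq in auto)
qed

text \<open>The minimiser of whichever function has the smaller minimum is a witness. A single
  \<open>u\<close> is produced, rather than a bound by a maximum, because it will serve as the
  action of a policy.\<close>

lemma exists_abs_Min_diff_le:
  fixes f g :: "'u::finite \<Rightarrow> real"
  shows "\<exists>u. \<bar>(MIN u. f u) - (MIN u. g u)\<bar> \<le> \<bar>f u - g u\<bar>"
proof -
  have "(MIN u. f u) \<in> range f" "(MIN u. g u) \<in> range g"
    by (simp_all add: Min_in)
  then obtain u v where u: "(MIN u. f u) = f u" and v: "(MIN u. g u) = g v"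
    by blast
  have "f u \<le> f v" "g v \<le> g u"
    using u v by (metis Min_le finite finite_imageI rangeI)+
  then show ?thesis
    unfolding u v by (cases "f u \<le> g v") (auto intro: exI[of _ u] exI[of _ v])
qed

section \<open>Total variation\<close>

lemma abs_integral_diff_le_2:
  fixes f :: "'a \<Rightarrow> real"
  assumes \<mu>: "\<mu> \<in> space (prob_algebra S)" and \<nu>: "\<nu> \<in> space (prob_algebra S)"
    and f: "f \<in> borel_measurable S" and bound: "\<And>x. x \<in> space S \<Longrightarrow> \<bar>f x\<bar> \<le> 1"
  shows "\<bar>(\<integral>x. f x \<partial>\<mu>) - (\<integral>x. f x \<partial>\<nu>)\<bar> \<le> 2"
proof -
  have le: "\<bar>\<integral>x. f x \<partial>\<kappa>\<bar> \<le> 1" if \<kappa>: "\<kappa> \<in> space (prob_algebra S)" for \<kappa>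
  proof -
    interpret prob_space \<kappa>
      using \<kappa> by (simp add: space_prob_algebra)
    have sp: "space \<kappa> = space S" and [measurable_cong]: "sets \<kappa> = sets S"
      using \<kappa> sets_eq_imp_space_eq[of \<kappa> S] by (auto simp: space_prob_algebra)
    have "integrable \<kappa> f"
      using f bound by (intro integrable_const_bound[where B=1] AE_I2) (auto simp: sp)
    then have "\<bar>\<integral>x. f x \<partial>\<kappa>\<bar> \<le> (\<integral>x. 1 \<partial>\<kappa>)"
      using bound by (intro order.trans[OF integral_abs_bound integral_mono]) (auto simp: sp)
    then show ?thesis
      by (simp add: prob_space)
  qed
  show ?thesis
    using le[OF \<mu>] le[OF \<nu>] by linarith
qed

text \<open>The supremum in \<open>tv_dist\<close> is one of real numbers, so every comparison with
  it needs boundedness first.\<close>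

lemma tv_dist_bdd_above:
  assumes "\<mu> \<in> space (prob_algebra S)" "\<nu> \<in> space (prob_algebra S)"
  shows "bdd_above ((\<lambda>f. \<bar>(\<integral>x. f x \<partial>\<mu>) - (\<integral>x. f x \<partial>\<nu>)\<bar>) `
           {f \<in> borel_measurable S. \<forall>x\<in>space S. \<bar>f x\<bar> \<le> (1::real)})"
  using abs_integral_diff_le_2[OF assms] by (intro bdd_aboveI2[where M=2]) auto

lemma
  assumes "\<mu> \<in> space (prob_algebra S)" "\<nu> \<in> space (prob_algebra S)"
  shows tv_dist_nonneg: "0 \<le> tv_dist S \<mu> \<nu>" and tv_dist_le_2: "tv_dist S \<mu> \<nu> \<le> 2"
proof -
  let ?F = "{f \<in> borel_measurable S. \<forall>x\<in>space S. \<bar>f x\<bar> \<le> (1::real)}"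
  have 0: "(\<lambda>_. 0) \<in> ?F"
    by simp
  show "0 \<le> tv_dist S \<mu> \<nu>"
    unfolding tv_dist_def using cSUP_upper[OF 0 tv_dist_bdd_above[OF assms]] by simp
  show "tv_dist S \<mu> \<nu> \<le> 2"
    unfolding tv_dist_def
  proof (rule cSUP_least)
    show "?F \<noteq> {}"
      using 0 by blast
  qed (use abs_integral_diff_le_2[OF assms] in auto)
qed

text \<open>Dividing by \<open>B\<close> turns \<open>f\<close> into a test function of the
  supremum. For \<open>B = 0\<close> the function vanishes on \<open>space S\<close>.\<close>

lemma abs_integral_diff_le_tv_dist:
  assumes "\<mu> \<in> space (prob_algebra S)" "\<nu> \<in> space (prob_algebra S)"
    and f: "f \<in> borel_measurable S" and bound: "\<And>x. x \<in> space S \<Longrightarrow> \<bar>f x\<bar> \<le> B" and "0 \<le> B"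
  shows "\<bar>(\<integral>x. f x \<partial>\<mu>) - (\<integral>x. f x \<partial>\<nu>)\<bar> \<le> B * tv_dist S \<mu> \<nu>"
proof (cases "B = 0")
  case True
  then have "(\<integral>x. f x \<partial>\<kappa>) = 0" if "\<kappa> \<in> space (prob_algebra S)" for \<kappa>
    using that bound sets_eq_imp_space_eq[of \<kappa> S]
    by (subst Bochner_Integration.integral_cong[where g="\<lambda>_. 0" and N=\<kappa>])
       (auto simp: space_prob_algebra)
  then show ?thesis
    using assms True by simp
next
  case False
  then have B: "0 < B"
    using \<open>0 \<le> B\<close> by simp
  have "\<bar>(\<integral>x. f x / B \<partial>\<mu>) - (\<integral>x. f x / B \<partial>\<nu>)\<bar> \<le> tv_dist S \<mu> \<nu>"
    unfolding tv_dist_def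
    by (rule cSUP_upper[OF _ tv_dist_bdd_above[OF assms(1,2)]]) (use f bound B in auto)
  then have "\<bar>((\<integral>x. f x \<partial>\<mu>) - (\<integral>x. f x \<partial>\<nu>)) / B\<bar> \<le> tv_dist S \<mu> \<nu>"
    by (simp add: diff_divide_distrib)
  then show ?thesis
    using B by (simp add: abs_div field_simps)
qed

section \<open>Filtering\<close>

locale pomdp_model =
  fixes P :: "('x::topological_space, 'y::finite, 'u::finite) pomdp"
  assumes valid: "valid_pomdp P"
begin

abbreviation "S \<equiv> state_space P"

lemma space_state_space: "space S = states P"
  by (simp add: state_space_def space_restrict_space)

lemma discount_range: "0 < discount P" "discount P < 1"
  using valid by (simp_all add: valid_pomdp_def)

lemma transition_kernel:
  "(\<lambda>(x, u). transition P x u) \<in> S \<Otimes>\<^sub>M count_space UNIV \<rightarrow>\<^sub>M prob_algebra S"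
  using valid by (simp add: valid_pomdp_def)

lemma transition_measurable [measurable]: "(\<lambda>x. transition P x u) \<in> S \<rightarrow>\<^sub>M prob_algebra S"
  using measurable_compose[OF measurable_Pair2'[of u "count_space UNIV" S] transition_kernel] by simp

lemma transition_subprob [measurable]: "(\<lambda>x. transition P x u) \<in> S \<rightarrow>\<^sub>M subprob_algebra S"
  by (intro measurable_prob_algebraD transition_measurable)

lemma transition_beliefs: "x \<in> space S \<Longrightarrow> transition P x u \<in> beliefs P"
  unfolding beliefs_def using measurable_space[OF transition_measurable] .

lemma observation_measurable: "observation P \<in> S \<rightarrow>\<^sub>M prob_algebra (count_space UNIV)"
  using valid by (simp add: valid_pomdp_def)

lemma observation_prob:
  assumes "x \<in> space S"
  shows "prob_space (observation P x)" "sets (observation P x) = UNIV"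
  using measurable_space[OF observation_measurable assms] by (auto simp: space_prob_algebra)

lemma obs_prob_measurable [measurable]: "obs_prob P y \<in> borel_measurable S"
  unfolding obs_prob_def
  by (rule measurable_compose[OF observation_measurable measurable_measure_prob_algebra]) simp

lemma obs_prob_nonneg [simp]: "0 \<le> obs_prob P y x"
  by (simp add: obs_prob_def)

lemma obs_prob_le_1: "x \<in> space S \<Longrightarrow> obs_prob P y x \<le> 1"
  unfolding obs_prob_def by (intro prob_space.prob_le_1 observation_prob)

lemma ennreal_obs_prob: "x \<in> space S \<Longrightarrow> ennreal (obs_prob P y x) = emeasure (observation P x) {y}"
  unfolding obs_prob_def
  by (metis finite_measure.emeasure_eq_measure observation_prob(1) prob_space.finite_measure)

lemma nn_integral_observation:
  assumes "x \<in> space S"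
  shows "(\<integral>\<^sup>+y. f y \<partial>observation P x) = (\<Sum>y\<in>UNIV. f y * ennreal (obs_prob P y x))"
  using assms by (simp add: nn_integral_finite_count_space observation_prob ennreal_obs_prob)

lemma sum_obs_prob:
  assumes "x \<in> space S"
  shows "(\<Sum>y\<in>UNIV. obs_prob P y x) = 1"
proof -
  interpret prob_space "observation P x"
    by (rule observation_prob[OF assms])
  have sp: "space (observation P x) = UNIV"
    using observation_prob(2)[OF assms] sets_eq_imp_space_eq[of "observation P x" "count_space UNIV"]
    by simp
  have "(\<Sum>y\<in>UNIV. obs_prob P y x) = prob (\<Union>y\<in>UNIV. {y})"
    unfolding obs_prob_def
    by (intro finite_measure_finite_Union[symmetric]) (auto simp: disjoint_family_on_def observation_prob assms)
  then show ?thesis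
    using prob_space sp by simp
qed

lemma beliefsD:
  assumes "\<pi> \<in> beliefs P"
  shows "prob_space \<pi>" "sets \<pi> = sets S" "space \<pi> = space S"
  using assms sets_eq_imp_space_eq[of \<pi> S] by (auto simp: beliefs_def space_prob_algebra)

lemma beliefsI: "prob_space \<pi> \<Longrightarrow> sets \<pi> = sets S \<Longrightarrow> \<pi> \<in> beliefs P"
  by (simp add: beliefs_def space_prob_algebra)

lemma integrable_beliefs:
  fixes f :: "'x \<Rightarrow> real"
  assumes "\<pi> \<in> beliefs P" "f \<in> borel_measurable S" "\<And>x. x \<in> space S \<Longrightarrow> \<bar>f x\<bar> \<le> B"
  shows "integrable \<pi> f"
proof -
  interpret prob_space \<pi>
    by (rule beliefsD[OF assms(1)])
  show ?thesis
    using assms(2,3) beliefsD[OF assms(1)]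
    by (intro integrable_const_bound[where B=B] AE_I2) (auto cong: measurable_cong_sets)
qed

lemma abs_integral_beliefs_le:
  fixes f :: "'x \<Rightarrow> real"
  assumes "\<pi> \<in> beliefs P" "f \<in> borel_measurable S" "\<And>x. x \<in> space S \<Longrightarrow> \<bar>f x\<bar> \<le> B"
  shows "\<bar>\<integral>x. f x \<partial>\<pi>\<bar> \<le> B"
proof -
  interpret prob_space \<pi>
    by (rule beliefsD[OF assms(1)])
  have "\<bar>\<integral>x. f x \<partial>\<pi>\<bar> \<le> (\<integral>x. B \<partial>\<pi>)"
    using integrable_beliefs[OF assms] assms(3) beliefsD(3)[OF assms(1)]
    by (intro order.trans[OF integral_abs_bound integral_mono]) auto
  then show ?thesis
    by (simp add: prob_space)
qed

abbreviation obs_mass :: "'x measure \<Rightarrow> 'y \<Rightarrow> real" where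
  "obs_mass \<pi> y \<equiv> \<integral>x. obs_prob P y x \<partial>\<pi>"

lemma integrable_obs_prob: "\<pi> \<in> beliefs P \<Longrightarrow> integrable \<pi> (obs_prob P y)"
  by (rule integrable_beliefs[where B=1]) (auto simp: obs_prob_le_1)

lemma obs_mass_nonneg: "0 \<le> obs_mass \<pi> y"
  by simp

lemma sum_obs_mass:
  assumes \<pi>: "\<pi> \<in> beliefs P"
  shows "(\<Sum>y\<in>UNIV. obs_mass \<pi> y) = 1"
proof -
  interpret prob_space \<pi>
    by (rule beliefsD[OF \<pi>])
  have "(\<Sum>y\<in>UNIV. obs_mass \<pi> y) = (\<integral>x. (\<Sum>y\<in>UNIV. obs_prob P y x) \<partial>\<pi>)"
    by (rule Bochner_Integration.integral_sum[symmetric]) (rule integrable_obs_prob[OF \<pi>])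
  also have "\<dots> = (\<integral>x. 1 \<partial>\<pi>)"
    using beliefsD(3)[OF \<pi>] by (intro Bochner_Integration.integral_cong) (auto simp: sum_obs_prob)
  finally show ?thesis
    by (simp add: prob_space)
qed

lemma ennreal_obs_mass:
  "\<pi> \<in> beliefs P \<Longrightarrow> ennreal (obs_mass \<pi> y) = (\<integral>\<^sup>+x. ennreal (obs_prob P y x) \<partial>\<pi>)"
  by (intro nn_integral_eq_integral[symmetric] integrable_obs_prob AE_I2 obs_prob_nonneg)

text \<open>Bayes' rule with the normalising constant multiplied out. If the observation has mass
  zero, its likelihood vanishes almost everywhere and both sides are zero, so later arguments need
  no case distinction on the mass.\<close>

lemma bayes_disintegration:
  assumes \<pi>: "\<pi> \<in> beliefs P" and f: "f \<in> borel_measurable S"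
  shows "(\<integral>\<^sup>+x. f x * ennreal (obs_prob P y x) \<partial>\<pi>) =
    ennreal (obs_mass \<pi> y) * (\<integral>\<^sup>+x. f x \<partial>bayes P \<pi> y)"
proof (cases "obs_mass \<pi> y = 0")
  case True
  have [measurable]: "obs_prob P y \<in> borel_measurable \<pi>"
    using beliefsD[OF \<pi>] by (simp cong: measurable_cong_sets)
  have "AE x in \<pi>. ennreal (obs_prob P y x) = 0"
    using True ennreal_obs_mass[OF \<pi>, of y] by (simp add: nn_integral_0_iff_AE)
  then have "(\<integral>\<^sup>+x. f x * ennreal (obs_prob P y x) \<partial>\<pi>) = (\<integral>\<^sup>+x. 0 \<partial>\<pi>)"
    by (intro nn_integral_cong_AE) auto
  then show ?thesis
    using True by simp
next
  case False
  have [measurable]: "obs_prob P y \<in> borel_measurable \<pi>" "f \<in> borel_measurable \<pi>"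
    using beliefsD[OF \<pi>] f by (simp_all cong: measurable_cong_sets)
  have pos: "0 < obs_mass \<pi> y"
    using False obs_mass_nonneg[of \<pi> y] by linarith
  have "ennreal (obs_mass \<pi> y) * (\<integral>\<^sup>+x. f x \<partial>bayes P \<pi> y) =
    (\<integral>\<^sup>+x. ennreal (obs_mass \<pi> y) * (ennreal (obs_prob P y x / obs_mass \<pi> y) * f x) \<partial>\<pi>)"
    using False by (simp add: bayes_def Let_def nn_integral_density nn_integral_cmult)
  also have "\<dots> = (\<integral>\<^sup>+x. f x * ennreal (obs_prob P y x) \<partial>\<pi>)"
  proof (rule nn_integral_cong)
    fix x
    have "ennreal (obs_mass \<pi> y) * ennreal (obs_prob P y x / obs_mass \<pi> y) = ennreal (obs_prob P y x)"
      using pos by (simp add: ennreal_mult[symmetric])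
    then show "ennreal (obs_mass \<pi> y) * (ennreal (obs_prob P y x / obs_mass \<pi> y) * f x) =
      f x * ennreal (obs_prob P y x)"
      by (metis mult.assoc mult.commute)
  qed
  finally show ?thesis ..
qed

lemma bayes_beliefs [intro]:
  assumes \<pi>: "\<pi> \<in> beliefs P"
  shows "bayes P \<pi> y \<in> beliefs P"
proof (cases "obs_mass \<pi> y = 0")
  case True
  then show ?thesis
    using valid by (simp add: bayes_def valid_pomdp_def)
next
  case False
  have pos: "0 < obs_mass \<pi> y"
    using False obs_mass_nonneg[of \<pi> y] by linarith
  have sets: "sets (bayes P \<pi> y) = sets S"
    using False beliefsD[OF \<pi>] by (simp add: bayes_def Let_def)
  \<comment> \<open>Disintegrating the constant 1 determines the total mass once the positive finite
    factor is cancelled.\<close>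
  have "ennreal (obs_mass \<pi> y) * emeasure (bayes P \<pi> y) (space (bayes P \<pi> y)) = ennreal (obs_mass \<pi> y)"
    using bayes_disintegration[OF \<pi>, of "\<lambda>_. 1" y] ennreal_obs_mass[OF \<pi>, of y] by simp
  then have "emeasure (bayes P \<pi> y) (space (bayes P \<pi> y)) = 1"
    using pos by (metis ennreal_mult_cancel_left ennreal_eq_0_iff ennreal_neq_top mult.right_neutral not_le)
  then show ?thesis
    by (intro beliefsI prob_spaceI sets)
qed

lemma propagate_beliefs [intro]:
  assumes "\<mu> \<in> beliefs P"
  shows "propagate P \<mu> u \<in> beliefs P"
  using assms transition_measurable
  unfolding propagate_def beliefs_def
  by (intro beliefsI[unfolded beliefs_def] prob_space_bind' sets_bind')

lemma nn_integral_propagate: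
  assumes \<mu>: "\<mu> \<in> beliefs P" and "f \<in> borel_measurable S"
  shows "(\<integral>\<^sup>+x. f x \<partial>propagate P \<mu> u) = (\<integral>\<^sup>+x. \<integral>\<^sup>+x'. f x' \<partial>transition P x u \<partial>\<mu>)"
  unfolding propagate_def
  using assms beliefsD[OF \<mu>]
  by (intro nn_integral_bind[where B=S]) (auto cong: measurable_cong_sets)

lemma obs_mass_transition_measurable [measurable]:
  "(\<lambda>x. obs_mass (transition P x u) y) \<in> borel_measurable S"
  by (rule measurable_compose[OF transition_subprob integral_measurable_subprob_algebra]) simp

lemma obs_mass_le_1: "\<pi> \<in> beliefs P \<Longrightarrow> obs_mass \<pi> y \<le> 1"
  using abs_integral_beliefs_le[of \<pi> "obs_prob P y" 1] by (simp add: obs_prob_le_1)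

lemma obs_mass_propagate:
  assumes \<mu>: "\<mu> \<in> beliefs P"
  shows "obs_mass (propagate P \<mu> u) y = (\<integral>x. obs_mass (transition P x u) y \<partial>\<mu>)"
proof -
  have "ennreal (obs_mass (propagate P \<mu> u) y) =
    (\<integral>\<^sup>+x. \<integral>\<^sup>+x'. ennreal (obs_prob P y x') \<partial>transition P x u \<partial>\<mu>)"
    using \<mu> by (simp add: ennreal_obs_mass nn_integral_propagate propagate_beliefs)
  also have "\<dots> = (\<integral>\<^sup>+x. ennreal (obs_mass (transition P x u) y) \<partial>\<mu>)"
    using beliefsD(3)[OF \<mu>] by (intro nn_integral_cong) (simp add: ennreal_obs_mass transition_beliefs)
  also have "\<dots> = ennreal (\<integral>x. obs_mass (transition P x u) y \<partial>\<mu>)"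
    using \<mu> by (intro nn_integral_eq_integral integrable_beliefs[where B=1] AE_I2)
      (auto simp: obs_mass_le_1 transition_beliefs)
  finally show ?thesis
    by (subst (asm) ennreal_inj) auto
qed

lemma filter_seq_beliefs: "\<pi> \<in> beliefs P \<Longrightarrow> filter_seq P \<pi> y u k \<in> beliefs P"
  by (induction k) auto

lemma posterior_beliefs: "\<pi> \<in> beliefs P \<Longrightarrow> posterior P \<pi> ys us \<in> beliefs P"
  unfolding posterior_def by (rule filter_seq_beliefs)

lemma predictor_beliefs: "\<pi> \<in> beliefs P \<Longrightarrow> predictor P \<pi> ys us t \<in> beliefs P"
  by (induction t) (auto simp: next_predictor_def)

lemma next_obs_prob_eq:
  "\<pi> \<in> beliefs P \<Longrightarrow> next_obs_prob P \<pi> ys us u y = obs_mass (propagate P (posterior P \<pi> ys us) u) y"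
  unfolding next_obs_prob_def by (intro obs_mass_propagate[symmetric] posterior_beliefs)

lemma next_obs_prob_nonneg: "0 \<le> next_obs_prob P \<pi> ys us u y"
  unfolding next_obs_prob_def by simp

section \<open>Restarting the filter at a later time\<close>

lemma filter_seq_cong:
  assumes "\<And>i. i \<le> k \<Longrightarrow> y i = y' i" "\<And>i. i < k \<Longrightarrow> u i = u' i"
  shows "filter_seq P \<pi> y u k = filter_seq P \<pi> y' u' k"
  using assms by (induction k) auto

lemma predictor_cong:
  assumes "\<And>i. i < t \<Longrightarrow> ys ! i = ys' ! i" "\<And>i. i < t \<Longrightarrow> us ! i = us' ! i"
  shows "predictor P \<pi> ys us t = predictor P \<pi> ys' us' t"
  using assms by (induction t) auto

lemma bayes_predictor: "bayes P (predictor P \<pi> ys us t) (ys ! t) = filter_seq P \<pi> ((!) ys) ((!) us) t"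
  by (induction t) (simp_all add: next_predictor_def)

text \<open>Flow property of the filter. The predictor at time \<open>t\<close> has absorbed the
  observations before \<open>t\<close> only, so the restarted filter correctly begins by
  conditioning on \<open>ys ! t\<close>.\<close>

lemma filter_seq_predictor:
  "filter_seq P (predictor P \<pi> ys us t) (\<lambda>i. ys ! (t + i)) (\<lambda>i. us ! (t + i)) k =
   filter_seq P \<pi> ((!) ys) ((!) us) (t + k)"
  by (induction k) (simp_all add: bayes_predictor)

text \<open>The link between the belief-MDP and the true dynamics: a window together with its
  predictor determines the conditional law given the whole history.\<close>

lemma posterior_zhat_at:
  assumes "length ys = Suc (t + N)" "length us = t + N"
  shows "posterior P (predictor P \<pi> ys us t) (take (Suc N) (drop t ys)) (take N (drop t us)) =
    posterior P \<pi> ys us"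
proof -
  have "posterior P (predictor P \<pi> ys us t) (take (Suc N) (drop t ys)) (take N (drop t us)) =
    filter_seq P (predictor P \<pi> ys us t) (\<lambda>i. ys ! (t + i)) (\<lambda>i. us ! (t + i)) N"
    unfolding posterior_def using assms by (simp, intro filter_seq_cong) auto
  then show ?thesis
    using assms by (simp add: filter_seq_predictor posterior_def)
qed

lemma posterior_snoc:
  assumes "length ys = Suc (length us)"
  shows "posterior P \<pi> (ys @ [y]) (us @ [u]) = bayes P (propagate P (posterior P \<pi> ys us) u) y"
proof -
  have "filter_seq P \<pi> ((!) (ys @ [y])) ((!) (us @ [u])) (length us) = posterior P \<pi> ys us"
    unfolding posterior_def using assms by (intro filter_seq_cong) (auto simp: nth_append)
  then show ?thesis
    using assms by (simp add: posterior_def nth_append)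
qed

end

section \<open>The joint law of state and history\<close>

context pomdp_model
begin

abbreviation "Q \<equiv> S \<Otimes>\<^sub>M (count_space UNIV :: ('y list \<times> 'u list) measure)"

text \<open>Histories carry the discrete sigma-algebra. Quantities computed from them, such as the
  filter mismatch or a value gap, are therefore measurable along the law, however irregular they are
  as functions of the belief.\<close>

lemma history_measurable: "(\<lambda>z. g (snd z)) \<in> Q \<rightarrow>\<^sub>M M" if "range g \<subseteq> space M"
  using that by (intro measurable_compose[OF measurable_snd]) auto

text \<open>There are countably many histories, so measurability can be checked in the state
  alone.\<close>

lemma measurable_by_history:
  assumes "\<And>h. (\<lambda>x. f (x, h)) \<in> S \<rightarrow>\<^sub>M M"
  shows "f \<in> Q \<rightarrow>\<^sub>M M"
proof -
  have "(\<lambda>z. f (fst z, snd z)) \<in> Q \<rightarrow>\<^sub>M M"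
    using measurable_compose[OF measurable_fst assms]
    by (rule measurable_compose_countable[where f="\<lambda>h z. f (fst z, h)"]) simp
  then show ?thesis
    by simp
qed

lemma section_measurable:
  "F \<in> Q \<rightarrow>\<^sub>M M \<Longrightarrow> (\<lambda>x. F (x, h)) \<in> S \<rightarrow>\<^sub>M M"
  by (rule measurable_compose[OF measurable_Pair2']) auto

text \<open>The last stage common to both clauses of \<open>law\<close>; \<open>h\<close> builds the
  new history from the emitted observation.\<close>

definition observe :: "('y \<Rightarrow> 'y list \<times> 'u list) \<Rightarrow> 'x \<Rightarrow> ('x \<times> 'y list \<times> 'u list) measure" where
  "observe h x = observation P x \<bind> (\<lambda>y. return Q (x, h y))"

lemma observe_measurable: "observe h \<in> S \<rightarrow>\<^sub>M prob_algebra Q"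
  unfolding observe_def[abs_def]
proof (rule measurable_bind_prob_space2[OF observation_measurable])
  have "(\<lambda>z. (fst z, h (snd z))) \<in> S \<Otimes>\<^sub>M count_space UNIV \<rightarrow>\<^sub>M Q"
    by (intro measurable_Pair measurable_fst measurable_compose[OF measurable_snd]) simp
  from measurable_compose[OF this measurable_return_prob_space]
  show "(\<lambda>(x, y). return Q (x, h y)) \<in> S \<Otimes>\<^sub>M count_space UNIV \<rightarrow>\<^sub>M prob_algebra Q"
    by (simp add: case_prod_beta)
qed

lemma nn_integral_observe:
  assumes x: "x \<in> space S" and F: "F \<in> borel_measurable Q"
  shows "(\<integral>\<^sup>+z. F z \<partial>observe h x) = (\<Sum>y\<in>UNIV. F (x, h y) * ennreal (obs_prob P y x))"
proof -
  have "(\<lambda>y. return Q (x, h y)) \<in> observation P x \<rightarrow>\<^sub>M subprob_algebra Q"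
    using x by (intro measurable_compose[OF _ return_measurable] measurable_Pair)
      (auto simp: measurable_def observation_prob)
  then have "(\<integral>\<^sup>+z. F z \<partial>observe h x) = (\<integral>\<^sup>+y. \<integral>\<^sup>+z. F z \<partial>return Q (x, h y) \<partial>observation P x)"
    unfolding observe_def by (rule nn_integral_bind[OF F])
  also have "\<dots> = (\<integral>\<^sup>+y. F (x, h y) \<partial>observation P x)"
    using x by (intro nn_integral_cong nn_integral_return F) (simp add: space_pair_measure)
  finally show ?thesis
    using x by (simp add: nn_integral_observation)
qed

text \<open>Reverses the order of sampling: instead of the state first and its observation second,
  the observation is drawn from its marginal and the state from the Bayes posterior. The finite sum
  over observations is exchanged with the integral, and \<open>bayes_disintegration\<close> treats
  each term.\<close>

lemma nn_integral_observe_bayes: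
  assumes \<nu>: "\<nu> \<in> beliefs P" and F: "F \<in> borel_measurable Q"
  shows "(\<integral>\<^sup>+x. \<integral>\<^sup>+z. F z \<partial>observe h x \<partial>\<nu>) =
    (\<Sum>y\<in>UNIV. ennreal (obs_mass \<nu> y) * (\<integral>\<^sup>+x. F (x, h y) \<partial>bayes P \<nu> y))"
proof -
  have "(\<integral>\<^sup>+x. \<integral>\<^sup>+z. F z \<partial>observe h x \<partial>\<nu>) =
    (\<integral>\<^sup>+x. (\<Sum>y\<in>UNIV. F (x, h y) * ennreal (obs_prob P y x)) \<partial>\<nu>)"
    using beliefsD(3)[OF \<nu>] by (intro nn_integral_cong) (simp add: nn_integral_observe F)
  also have "\<dots> = (\<Sum>y\<in>UNIV. \<integral>\<^sup>+x. F (x, h y) * ennreal (obs_prob P y x) \<partial>\<nu>)"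
    using section_measurable[OF F] beliefsD(2)[OF \<nu>]
    by (intro nn_integral_sum borel_measurable_times_ennreal) (auto cong: measurable_cong_sets)
  also have "\<dots> = (\<Sum>y\<in>UNIV. ennreal (obs_mass \<nu> y) * (\<integral>\<^sup>+x. F (x, h y) \<partial>bayes P \<nu> y))"
    by (intro sum.cong refl bayes_disintegration[OF \<nu>] section_measurable F)
  finally show ?thesis .
qed

end

section \<open>The law under a policy and its disintegration along the history\<close>

locale controlled_pomdp = pomdp_model P
  for P :: "('x::topological_space, 'y::finite, 'u::finite) pomdp" +
  fixes N :: nat and \<pi>\<^sub>0 :: "'x measure"
  assumes prior: "\<pi>\<^sub>0 \<in> beliefs P"
begin

abbreviation act where "act \<gamma> n h \<equiv> action P N \<pi>\<^sub>0 \<gamma> n (fst h) (snd h)"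
abbreviation ext where "ext \<gamma> n h y \<equiv> (fst h @ [y], snd h @ [act \<gamma> n h])"
abbreviation post where "post h \<equiv> posterior P \<pi>\<^sub>0 (fst h) (snd h)"

text \<open>The Markov kernel that makes \<open>law\<close> an iterated bind on
  \<open>Q\<close>.\<close>

definition law_kernel where
  "law_kernel \<gamma> n z = transition P (fst z) (act \<gamma> n (snd z)) \<bind> observe (ext \<gamma> n (snd z))"

lemma law_0: "law P N \<pi>\<^sub>0 \<gamma> 0 = \<pi>\<^sub>0 \<bind> observe (\<lambda>y. ([y], []))"
  by (simp add: observe_def[abs_def])

lemma law_Suc: "law P N \<pi>\<^sub>0 \<gamma> (Suc n) = law P N \<pi>\<^sub>0 \<gamma> n \<bind> law_kernel \<gamma> n"
  by (simp add: observe_def[abs_def] law_kernel_def[abs_def] case_prod_beta' Let_def)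

lemma law_kernel_measurable: "law_kernel \<gamma> n \<in> Q \<rightarrow>\<^sub>M prob_algebra Q"
  unfolding law_kernel_def[abs_def]
  by (rule measurable_by_history)
     (auto intro!: measurable_bind_prob_space[OF _ observe_measurable])

lemma law_space: "law P N \<pi>\<^sub>0 \<gamma> n \<in> space (prob_algebra Q)"
proof (induction n)
  case 0
  show ?case
    unfolding law_0 using prior observe_measurable
    by (auto simp: beliefs_def space_prob_algebra[of Q] intro!: prob_space_bind' sets_bind')
next
  case (Suc n)
  then show ?case
    unfolding law_Suc
    using prob_space_bind'[OF Suc law_kernel_measurable] sets_bind'[OF Suc law_kernel_measurable]
    by (simp add: space_prob_algebra)
qed

lemma prob_space_law: "prob_space (law P N \<pi>\<^sub>0 \<gamma> n)"
  and sets_law [simp, measurable_cong]: "sets (law P N \<pi>\<^sub>0 \<gamma> n) = sets Q"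
  using law_space[of \<gamma> n] by (simp_all add: space_prob_algebra)

lemma space_law: "space (law P N \<pi>\<^sub>0 \<gamma> n) = space S \<times> UNIV"
  using sets_eq_imp_space_eq[OF sets_law] by (simp add: space_pair_measure)

lemma nn_integral_law_0:
  assumes F: "F \<in> borel_measurable Q"
  shows "(\<integral>\<^sup>+z. F z \<partial>law P N \<pi>\<^sub>0 \<gamma> 0) =
    (\<Sum>y\<in>UNIV. ennreal (obs_mass \<pi>\<^sub>0 y) * (\<integral>\<^sup>+x. F (x, [y], []) \<partial>bayes P \<pi>\<^sub>0 y))"
proof -
  have "(\<integral>\<^sup>+z. F z \<partial>law P N \<pi>\<^sub>0 \<gamma> 0) = (\<integral>\<^sup>+x. \<integral>\<^sup>+z. F z \<partial>observe (\<lambda>y. ([y], [])) x \<partial>\<pi>\<^sub>0)"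
    unfolding law_0 using measurable_prob_algebraD[OF observe_measurable] beliefsD(2)[OF prior]
    by (intro nn_integral_bind[OF F]) (simp cong: measurable_cong_sets)
  then show ?thesis
    by (simp add: nn_integral_observe_bayes[OF prior F])
qed

lemma nn_integral_law_Suc:
  assumes F: "F \<in> borel_measurable Q"
  shows "(\<integral>\<^sup>+z. F z \<partial>law P N \<pi>\<^sub>0 \<gamma> (Suc n)) = (\<integral>\<^sup>+z. \<integral>\<^sup>+z'. F z' \<partial>law_kernel \<gamma> n z \<partial>law P N \<pi>\<^sub>0 \<gamma> n)"
  unfolding law_Suc using measurable_prob_algebraD[OF law_kernel_measurable]
  by (intro nn_integral_bind[OF F]) (simp cong: measurable_cong_sets)

lemma nn_integral_law_kernel_measurable:
  assumes F: "F \<in> borel_measurable Q"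
  shows "(\<lambda>z. \<integral>\<^sup>+z'. F z' \<partial>law_kernel \<gamma> n z) \<in> borel_measurable Q"
  by (rule measurable_compose[OF measurable_prob_algebraD[OF law_kernel_measurable]
        nn_integral_measurable_subprob_algebra[OF F]])

lemma nn_integral_law_kernel:
  assumes x: "x \<in> space S" and F: "F \<in> borel_measurable Q"
  shows "(\<integral>\<^sup>+z. F z \<partial>law_kernel \<gamma> n (x, h)) =
    (\<integral>\<^sup>+x'. \<integral>\<^sup>+z. F z \<partial>observe (ext \<gamma> n h) x' \<partial>transition P x (act \<gamma> n h))"
  unfolding law_kernel_def
  using measurable_prob_algebraD[OF observe_measurable] beliefsD(2)[OF transition_beliefs[OF x]]
  by (simp, intro nn_integral_bind[OF F]) (simp cong: measurable_cong_sets)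

text \<open>With the history fixed, one step of the process started from a belief is one step of the
  filter: prediction by \<open>propagate\<close>, then a Bayes update.\<close>

lemma nn_integral_law_kernel_beliefs:
  assumes \<mu>: "\<mu> \<in> beliefs P" and F: "F \<in> borel_measurable Q"
  shows "(\<integral>\<^sup>+x. \<integral>\<^sup>+z. F z \<partial>law_kernel \<gamma> n (x, h) \<partial>\<mu>) =
    (let \<nu> = propagate P \<mu> (act \<gamma> n h) in
     \<Sum>y\<in>UNIV. ennreal (obs_mass \<nu> y) * (\<integral>\<^sup>+x. F (x, ext \<gamma> n h y) \<partial>bayes P \<nu> y))"
proof -
  have "(\<integral>\<^sup>+x. \<integral>\<^sup>+z. F z \<partial>law_kernel \<gamma> n (x, h) \<partial>\<mu>) =
    (\<integral>\<^sup>+x. \<integral>\<^sup>+x'. \<integral>\<^sup>+z. F z \<partial>observe (ext \<gamma> n h) x' \<partial>transition P x (act \<gamma> n h) \<partial>\<mu>)"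
    using beliefsD(3)[OF \<mu>] by (intro nn_integral_cong) (simp add: nn_integral_law_kernel F)
  also have "\<dots> = (\<integral>\<^sup>+x'. \<integral>\<^sup>+z. F z \<partial>observe (ext \<gamma> n h) x' \<partial>propagate P \<mu> (act \<gamma> n h))"
    by (intro nn_integral_propagate[symmetric] \<mu>
        measurable_compose[OF measurable_prob_algebraD[OF observe_measurable]
          nn_integral_measurable_subprob_algebra[OF F]])
  finally show ?thesis
    by (simp add: nn_integral_observe_bayes[OF propagate_beliefs[OF \<mu>] F] Let_def)
qed

text \<open>The law is a measure on all pairs of lists, while \<open>posterior\<close> and
  \<open>zhat_at\<close> read lists by index and length and are meaningful only for the right
  lengths. By induction the histories of wrong length have integral zero.\<close>

lemma AE_law_length:
  "AE z in law P N \<pi>\<^sub>0 \<gamma> n. length (fst (snd z)) = Suc n \<and> length (snd (snd z)) = n"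
proof -
  define bad :: "nat \<Rightarrow> 'y list \<times> 'u list \<Rightarrow> ennreal" where
    "bad n = indicator {h. \<not> (length (fst h) = Suc n \<and> length (snd h) = n)}" for n
  have meas: "(\<lambda>z. bad n (snd z)) \<in> borel_measurable Q" for n
    by (rule history_measurable) simp
  have "(\<integral>\<^sup>+z. bad n (snd z) \<partial>law P N \<pi>\<^sub>0 \<gamma> n) = 0"
  proof (induction n)
    case 0
    show ?case
      by (subst nn_integral_law_0[OF meas]) (simp add: bad_def)
  next
    case (Suc n)
    have "AE z in law P N \<pi>\<^sub>0 \<gamma> n. bad n (snd z) = 0"
      using Suc meas by (subst (asm) nn_integral_0_iff_AE) simp_all
    moreover have "(\<integral>\<^sup>+z'. bad (Suc n) (snd z') \<partial>law_kernel \<gamma> n z) = 0"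
      if "bad n (snd z) = 0" "z \<in> space (law P N \<pi>\<^sub>0 \<gamma> n)" for z
    proof -
      obtain x h where z: "z = (x, h)" "x \<in> space S"
        using \<open>z \<in> space _\<close> by (cases z) (auto simp: space_law)
      have len: "length (fst h) = Suc n" "length (snd h) = n"
        using that(1) by (auto simp: z bad_def indicator_eq_0_iff)
      then have "bad (Suc n) (ext \<gamma> n h y) = 0" for y
        by (simp add: bad_def)
      then have "(\<integral>\<^sup>+z'. bad (Suc n) (snd z') \<partial>law_kernel \<gamma> n z) =
        (\<integral>\<^sup>+x'. 0 \<partial>transition P x (act \<gamma> n h))"
        unfolding z using beliefsD(3)[OF transition_beliefs[OF z(2)]]
        by (subst nn_integral_law_kernel[OF z(2) meas], intro nn_integral_cong)
           (simp add: nn_integral_observe[OF _ meas])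
      then show ?thesis
        by simp
    qed
    ultimately have "(\<integral>\<^sup>+z. \<integral>\<^sup>+z'. bad (Suc n) (snd z') \<partial>law_kernel \<gamma> n z \<partial>law P N \<pi>\<^sub>0 \<gamma> n) =
      (\<integral>\<^sup>+z. 0 \<partial>law P N \<pi>\<^sub>0 \<gamma> n)"
      by (intro nn_integral_cong_AE) auto
    then show ?case
      unfolding nn_integral_law_Suc[OF meas] by simp
  qed
  then have "AE z in law P N \<pi>\<^sub>0 \<gamma> n. bad n (snd z) = 0"
    using meas by (subst (asm) nn_integral_0_iff_AE) simp_all
  then show ?thesis
    by (rule AE_mp) (auto simp: bad_def indicator_eq_0_iff)
qed

text \<open>The filter is the conditional law of the state given the history. In the induction step
  the hypothesis redraws the current state from the filter, the kernel turns this into observation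
  masses and Bayes updates, and \<open>posterior_snoc\<close> recognises the filter of the extended
  history.\<close>

lemma law_disintegration:
  assumes "F \<in> borel_measurable Q"
  shows "(\<integral>\<^sup>+z. F z \<partial>law P N \<pi>\<^sub>0 \<gamma> n) = (\<integral>\<^sup>+z. \<integral>\<^sup>+x. F (x, snd z) \<partial>post (snd z) \<partial>law P N \<pi>\<^sub>0 \<gamma> n)"
  using assms
proof (induction n arbitrary: F)
  case 0
  have meas: "(\<lambda>z. \<integral>\<^sup>+x. F (x, snd z) \<partial>post (snd z)) \<in> borel_measurable Q"
    by (rule history_measurable) simp
  interpret b: prob_space "bayes P \<pi>\<^sub>0 y" for y
    by (intro beliefsD bayes_beliefs prior)
  show ?case
    by (simp only: nn_integral_law_0[OF 0] nn_integral_law_0[OF meas])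
       (simp add: posterior_def b.emeasure_space_1)
next
  case (Suc n)
  have step: "(\<integral>\<^sup>+z. G z \<partial>law P N \<pi>\<^sub>0 \<gamma> (Suc n)) =
    (\<integral>\<^sup>+z. (\<Sum>y\<in>UNIV. ennreal (obs_mass (propagate P (post (snd z)) (act \<gamma> n (snd z))) y) *
       (\<integral>\<^sup>+x. G (x, ext \<gamma> n (snd z) y) \<partial>post (ext \<gamma> n (snd z) y))) \<partial>law P N \<pi>\<^sub>0 \<gamma> n)"
    if G: "G \<in> borel_measurable Q" for G
  proof -
    have "(\<integral>\<^sup>+z. G z \<partial>law P N \<pi>\<^sub>0 \<gamma> (Suc n)) =
      (\<integral>\<^sup>+z. \<integral>\<^sup>+x. \<integral>\<^sup>+z'. G z' \<partial>law_kernel \<gamma> n (x, snd z) \<partial>post (snd z) \<partial>law P N \<pi>\<^sub>0 \<gamma> n)"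
      by (subst nn_integral_law_Suc[OF G], rule Suc.IH) (rule nn_integral_law_kernel_measurable[OF G])
    also have "\<dots> = (\<integral>\<^sup>+z. (\<Sum>y\<in>UNIV. ennreal (obs_mass (propagate P (post (snd z)) (act \<gamma> n (snd z))) y) *
       (\<integral>\<^sup>+x. G (x, ext \<gamma> n (snd z) y) \<partial>post (ext \<gamma> n (snd z) y))) \<partial>law P N \<pi>\<^sub>0 \<gamma> n)"
      using AE_law_length[where \<gamma>=\<gamma> and n=n]
    proof (intro nn_integral_cong_AE, eventually_elim)
      case (elim z)
      then show ?case
        by (simp add: nn_integral_law_kernel_beliefs[OF posterior_beliefs[OF prior] G] Let_def
            posterior_snoc)
    qed
    finally show ?thesis .
  qed
  have meas: "(\<lambda>z. \<integral>\<^sup>+x. F (x, snd z) \<partial>post (snd z)) \<in> borel_measurable Q"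
    by (rule history_measurable) simp
  interpret b: prob_space "posterior P \<pi>\<^sub>0 ys us" for ys us
    by (intro beliefsD posterior_beliefs prior)
  \<comment> \<open>The integrand on the right depends on the history only, so \<open>step\<close>
    integrates a constant against a probability measure, and both sides become the same sum.\<close>
  show ?case
    unfolding step[OF Suc.prems] step[OF meas] by (simp add: b.emeasure_space_1)
qed

text \<open>With the hidden state integrated out, histories evolve on their own with transition
  probabilities \<open>next_obs_prob\<close>, the same weights as in the Bellman equations.\<close>

lemma nn_integral_law_history_Suc:
  "(\<integral>\<^sup>+z. G (snd z) \<partial>law P N \<pi>\<^sub>0 \<gamma> (Suc n)) =
   (\<integral>\<^sup>+z. (\<Sum>y\<in>UNIV. ennreal (next_obs_prob P \<pi>\<^sub>0 (fst (snd z)) (snd (snd z)) (act \<gamma> n (snd z)) y) *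
      G (ext \<gamma> n (snd z) y)) \<partial>law P N \<pi>\<^sub>0 \<gamma> n)"
proof -
  have G: "(\<lambda>z. G (snd z)) \<in> borel_measurable Q"
    by (rule history_measurable) simp
  interpret b: prob_space "bayes P (propagate P (post h) u) y" for h u y
    by (intro beliefsD posterior_beliefs prior bayes_beliefs propagate_beliefs)
  show ?thesis
    by (subst nn_integral_law_Suc[OF G], subst law_disintegration[OF nn_integral_law_kernel_measurable[OF G]])
       (simp add: nn_integral_law_kernel_beliefs[OF posterior_beliefs[OF prior] G] Let_def
          b.emeasure_space_1 next_obs_prob_eq[OF prior])
qed

end

section \<open>Feedback policies and iteration of a one-step inequality\<close>

context controlled_pomdp
begin

lemma zhat_space_iff:
  "(\<pi>, ys, us) \<in> space (zhat_space P N) \<longleftrightarrow> \<pi> \<in> beliefs P \<and> length ys = Suc N \<and> length us = N"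
  by (simp add: zhat_space_def space_pair_measure beliefs_def)

text \<open>Distinct windows are separated by discrete rectangles. Distinct beliefs differ on some
  set \<open>A\<close>, and a level set of the measurable evaluation at \<open>A\<close> separates
  them.\<close>

lemma zhat_space_separated:
  assumes "z \<in> space (zhat_space P N)" "z' \<in> space (zhat_space P N)" "z \<noteq> z'"
  shows "\<exists>A\<in>sets (zhat_space P N). z \<in> A \<and> z' \<notin> A"
proof -
  let ?W = "count_space {ys :: 'y list. length ys = Suc N} \<Otimes>\<^sub>M count_space {us :: 'u list. length us = N}"
  let ?B = "prob_algebra S"
  obtain \<pi> ys us \<pi>' ys' us' where z: "z = (\<pi>, ys, us)" "z' = (\<pi>', ys', us')"
    by (metis prod_cases3)
  have mem: "\<pi> \<in> space ?B" "\<pi>' \<in> space ?B" "length ys = Suc N" "length us = N"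
    using assms by (auto simp: z zhat_space_iff beliefs_def)
  show ?thesis
  proof (cases "\<pi> = \<pi>'")
    case True
    have "space ?B \<times> ({ys} \<times> {us}) \<in> sets (zhat_space P N)"
      unfolding zhat_space_def using mem by (intro pair_measureI) auto
    then show ?thesis
      using assms(3) True mem by (intro bexI[where x="space ?B \<times> ({ys} \<times> {us})"]) (auto simp: z)
  next
    case False
    have "sets \<pi> = sets \<pi>'" "sets \<pi>' = sets S"
      using mem by (simp_all add: space_prob_algebra)
    then obtain A where A: "A \<in> sets S" "emeasure \<pi> A \<noteq> emeasure \<pi>' A"
      using False measure_eqI[of \<pi> \<pi>'] by metis
    have "(\<lambda>\<mu>. emeasure \<mu> A) \<in> borel_measurable ?B"
      unfolding prob_algebra_def
      by (intro measurable_restrict_space1 measurable_emeasure_subprob_algebra A)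
    then have "(\<lambda>\<mu>. emeasure \<mu> A) -` {emeasure \<pi> A} \<inter> space ?B \<in> sets ?B"
      by (rule measurable_sets) simp
    then have sets: "((\<lambda>\<mu>. emeasure \<mu> A) -` {emeasure \<pi> A} \<inter> space ?B) \<times> space ?W \<in> sets (zhat_space P N)"
      unfolding zhat_space_def by (intro pair_measureI) auto
    show ?thesis
    proof (rule bexI[OF _ sets], rule conjI)
      show "z \<in> ((\<lambda>\<mu>. emeasure \<mu> A) -` {emeasure \<pi> A} \<inter> space ?B) \<times> space ?W"
        using mem by (simp add: z space_pair_measure)
      show "z' \<notin> ((\<lambda>\<mu>. emeasure \<mu> A) -` {emeasure \<pi> A} \<inter> space ?B) \<times> space ?W"
        using A(2) by (auto simp: z)
    qed
  qed
qed

text \<open>From \<open>\<pi>\<^sub>0\<close> only the finitely many states in \<open>R t\<close>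
  can occur at time \<open>t\<close>, so a measurable map agreeing with \<open>a\<close> on them
  suffices. The first \<open>N\<close> actions remain at the disposal of \<open>f\<close>.\<close>

lemma exists_feedback_policy:
  fixes a :: "('x, 'y, 'u) zhat \<Rightarrow> 'u"
  obtains \<gamma>' where "\<gamma>' \<in> policies P N" "fst \<gamma>' = f"
    "\<And>t ys us. length ys = Suc (t + N) \<Longrightarrow> length us = t + N \<Longrightarrow>
       action P N \<pi>\<^sub>0 \<gamma>' (t + N) ys us = a (zhat_at P N \<pi>\<^sub>0 ys us t)"
proof -
  define R where "R t = (\<lambda>(ys, us). zhat_at P N \<pi>\<^sub>0 ys us t) `
    ({ys. length ys = Suc (t + N)} \<times> {us. length us = t + N})" for t
  have "\<exists>g\<in>zhat_space P N \<rightarrow>\<^sub>M count_space UNIV. \<forall>z\<in>R t. g z = a z" for t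
  proof (rule exists_measurable_eq_on_finite)
    show "finite (R t)"
      unfolding R_def by (intro finite_imageI finite_cartesian_product finite_lists_length)
    show "R t \<subseteq> space (zhat_space P N)"
      by (auto simp: R_def zhat_at_def zhat_space_iff predictor_beliefs prior)
  qed (rule zhat_space_separated)
  then obtain g where g: "\<And>t. g t \<in> zhat_space P N \<rightarrow>\<^sub>M count_space UNIV"
    "\<And>t z. z \<in> R t \<Longrightarrow> g t z = a z"
    by metis
  have "(\<lambda>zs. g t (zs t)) \<in> (\<Pi>\<^sub>M i\<in>{..t}. zhat_space P N) \<rightarrow>\<^sub>M count_space UNIV" for t
    by (rule measurable_compose[OF measurable_component_singleton[where M="\<lambda>_. zhat_space P N"] g(1)]) simp
  then have "(f, \<lambda>t zs. g t (zs t)) \<in> policies P N"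
    by (simp add: policies_def)
  moreover have "action P N \<pi>\<^sub>0 (f, \<lambda>t zs. g t (zs t)) (t + N) ys us = a (zhat_at P N \<pi>\<^sub>0 ys us t)"
    if "length ys = Suc (t + N)" "length us = t + N" for t ys us
    using that by (auto simp: action_def R_def intro!: g(2))
  ultimately show ?thesis
    using that by simp
qed

text \<open>\<open>action\<close> consults the feedback component only from time \<open>N\<close>
  on. Hence an expectation over the initial window may be computed with any continuation of the
  policy.\<close>

lemma law_cong_initial:
  assumes "fst \<gamma> = fst \<gamma>'" "n \<le> N"
  shows "law P N \<pi>\<^sub>0 \<gamma> n = law P N \<pi>\<^sub>0 \<gamma>' n"
  using assms(2)
proof (induction n)
  case (Suc n)
  then have "law_kernel \<gamma> n = law_kernel \<gamma>' n"
    by (simp add: law_kernel_def[abs_def] action_def assms(1))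
  then show ?case
    using Suc by (simp only: law_Suc)
qed simp

text \<open>Matches one step of the true history with the successor state that appears inside
  \<open>bellman\<close>.\<close>

lemma zhat_at_snoc:
  assumes "length ys = Suc (t + N)" "length us = t + N" "zhat_at P N \<pi>\<^sub>0 ys us t = (\<pi>, w, v)"
  shows "zhat_at P N \<pi>\<^sub>0 (ys @ [y]) (us @ [u]) (Suc t) =
    (next_predictor P \<pi> (hd w) (hd (v @ [u])), tl (w @ [y]), tl (v @ [u]))"
proof -
  have eq: "\<pi> = predictor P \<pi>\<^sub>0 ys us t" "w = drop t ys" "v = drop t us"
    using assms by (simp_all add: zhat_at_def)
  have snoc: "drop t (ys @ [y]) = drop t ys @ [y]" "drop t (us @ [u]) = drop t us @ [u]"
    using assms by simp_all
  have pred: "predictor P \<pi>\<^sub>0 (ys @ [y]) (us @ [u]) t = \<pi>"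
    unfolding eq using assms(1,2) by (intro predictor_cong) (auto simp: nth_append)
  have hd_w: "(ys @ [y]) ! t = hd w"
    using assms(1) by (simp add: eq hd_drop_conv_nth nth_append)
  \<comment> \<open>For \<open>N = 0\<close> the window \<open>v\<close> is empty and the action
    entering the predictor is the new \<open>u\<close> itself.\<close>
  have hd_v: "(us @ [u]) ! t = hd (v @ [u])"
    using assms(2) by (cases "N = 0") (simp_all add: eq hd_append hd_drop_conv_nth nth_append)
  have tl_w: "drop (Suc t) (ys @ [y]) = tl (w @ [y])"
    by (simp only: eq snoc[symmetric] drop_Suc tl_drop)
  have tl_v: "drop (Suc t) (us @ [u]) = tl (v @ [u])"
    by (simp only: eq snoc[symmetric] drop_Suc tl_drop)
  have "length (tl (w @ [y])) \<le> Suc N" "length (tl (v @ [u])) \<le> N"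
    using assms(1,2) by (simp_all add: eq)
  then show ?thesis
    unfolding zhat_at_def predictor.simps pred hd_w hd_v tl_w tl_v by (simp only: take_all)
qed

section \<open>Bounds on the filter mismatch and on the L-terms\<close>

lemma filter_mismatch_range:
  assumes "\<pi>s \<in> beliefs P" "\<pi> \<in> beliefs P"
  shows "0 \<le> filter_mismatch P \<pi>s (\<pi>, h)" "filter_mismatch P \<pi>s (\<pi>, h) \<le> 2"
  using assms posterior_beliefs[unfolded beliefs_def]
  by (auto simp: filter_mismatch_def case_prod_beta beliefs_def intro!: tv_dist_nonneg tv_dist_le_2)

abbreviation mismatch_at where
  "mismatch_at \<pi>s t z \<equiv> filter_mismatch P \<pi>s (zhat_at P N \<pi>\<^sub>0 (fst (snd z)) (snd (snd z)) t)"

lemma mismatch_at_range: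
  assumes "\<pi>s \<in> beliefs P"
  shows "0 \<le> mismatch_at \<pi>s t z" "mismatch_at \<pi>s t z \<le> 2"
  unfolding zhat_at_def
  by (intro filter_mismatch_range assms predictor_beliefs prior)+

lemma integrable_mismatch_at:
  assumes "\<pi>s \<in> beliefs P"
  shows "integrable (law P N \<pi>\<^sub>0 \<gamma> n) (mismatch_at \<pi>s t)"
proof -
  interpret prob_space "law P N \<pi>\<^sub>0 \<gamma> n"
    by (rule prob_space_law)
  have "mismatch_at \<pi>s t \<in> borel_measurable Q"
    by (rule history_measurable) simp
  then show ?thesis
    using mismatch_at_range[OF assms] by (intro integrable_const_bound[where B=2]) auto
qed

lemma expectation_mismatch_le_2:
  assumes "\<pi>s \<in> beliefs P"
  shows "(\<integral>z. mismatch_at \<pi>s t z \<partial>law P N \<pi>\<^sub>0 \<gamma> n) \<le> 2"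
proof -
  interpret prob_space "law P N \<pi>\<^sub>0 \<gamma> n"
    by (rule prob_space_law)
  show ?thesis
    by (intro integral_le_const integrable_mismatch_at assms AE_I2 mismatch_at_range)
qed

lemma L_term_eq:
  "L_term P N \<pi>s \<pi>\<^sub>0 t = (SUP \<gamma>\<in>policies P N. \<integral>z. mismatch_at \<pi>s t z \<partial>law P N \<pi>\<^sub>0 \<gamma> (t + N))"
  by (simp add: L_term_def case_prod_beta')

lemma expectation_mismatch_le_L_term:
  assumes "\<pi>s \<in> beliefs P" "\<gamma> \<in> policies P N"
  shows "(\<integral>z. mismatch_at \<pi>s t z \<partial>law P N \<pi>\<^sub>0 \<gamma> (t + N)) \<le> L_term P N \<pi>s \<pi>\<^sub>0 t"
  unfolding L_term_eq using assms expectation_mismatch_le_2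
  by (intro cSUP_upper bdd_aboveI2[where M=2]) auto

lemma L_term_range:
  assumes "\<pi>s \<in> beliefs P"
  shows "0 \<le> L_term P N \<pi>s \<pi>\<^sub>0 t" "L_term P N \<pi>s \<pi>\<^sub>0 t \<le> 2"
proof -
  \<comment> \<open>A real supremum is informative only over a nonempty index set, so one policy has
    to be exhibited.\<close>
  obtain \<gamma> where \<gamma>: "\<gamma> \<in> policies P N"
    using exists_feedback_policy by metis
  have "0 \<le> (\<integral>z. mismatch_at \<pi>s t z \<partial>law P N \<pi>\<^sub>0 \<gamma> (t + N))"
    by (intro integral_nonneg_AE AE_I2 mismatch_at_range assms)
  then show "0 \<le> L_term P N \<pi>s \<pi>\<^sub>0 t"
    using expectation_mismatch_le_L_term[OF assms \<gamma>, of t] by linarith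
  show "L_term P N \<pi>s \<pi>\<^sub>0 t \<le> 2"
    unfolding L_term_eq using \<gamma> by (intro cSUP_least expectation_mismatch_le_2 assms) auto
qed

lemma nn_integral_mismatch_le_L_term:
  assumes "\<pi>s \<in> beliefs P" "\<gamma> \<in> policies P N"
  shows "(\<integral>\<^sup>+z. ennreal (mismatch_at \<pi>s t z) \<partial>law P N \<pi>\<^sub>0 \<gamma> (t + N)) \<le> ennreal (L_term P N \<pi>s \<pi>\<^sub>0 t)"
  using expectation_mismatch_le_L_term[OF assms]
  by (subst nn_integral_eq_integral[OF integrable_mismatch_at[OF assms(1)]])
     (auto intro!: ennreal_leI AE_I2 mismatch_at_range assms)

text \<open>\<open>next_obs_prob\<close> sees the past only through the posterior, which
  \<open>posterior_zhat_at\<close> identifies for window and full history.\<close>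

lemma next_obs_prob_zhat_at:
  assumes "length ys = Suc (t + N)" "length us = t + N" "zhat_at P N \<pi>\<^sub>0 ys us t = (\<pi>, w, v)"
  shows "next_obs_prob P \<pi> w v u y = next_obs_prob P \<pi>\<^sub>0 ys us u y"
  using assms(3) posterior_zhat_at[OF assms(1,2), of \<pi>\<^sub>0]
  by (auto simp: next_obs_prob_def zhat_at_def)

lemma ennreal_affine_sum:
  assumes "0 \<le> k" "0 \<le> m" "0 \<le> b" "\<And>y. 0 \<le> q y" "\<And>y. 0 \<le> d y"
  shows "ennreal (k * m + b * (\<Sum>y\<in>A. q y * d y)) =
    ennreal k * ennreal m + ennreal b * (\<Sum>y\<in>A. ennreal (q y) * ennreal (d y))"
proof -
  have "ennreal (k * m + b * (\<Sum>y\<in>A. q y * d y)) = ennreal (k * m) + ennreal (b * (\<Sum>y\<in>A. q y * d y))"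
    using assms by (intro ennreal_plus mult_nonneg_nonneg sum_nonneg)
  also have "ennreal (b * (\<Sum>y\<in>A. q y * d y)) = ennreal b * (\<Sum>y\<in>A. ennreal (q y * d y))"
    using assms by (subst ennreal_mult) (simp_all add: sum_nonneg sum_ennreal)
  finally show ?thesis
    using assms by (simp add: ennreal_mult)
qed

text \<open>The iteration is isolated from the value functions: \<open>D\<close> stands for a gap,
  \<open>a\<close> for the actions at which its one-step inequality holds, and \<open>C\<close> for
  a crude bound that the discount will damp.\<close>

context
  fixes D :: "('x, 'y, 'u) zhat \<Rightarrow> real" and a :: "('x, 'y, 'u) zhat \<Rightarrow> 'u" and K C :: real
    and \<pi>s :: "'x measure"
  assumes \<pi>s: "\<pi>s \<in> beliefs P"
    and K: "0 \<le> K"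
    and D_nonneg: "\<And>z. 0 \<le> D z"
    and D_bounded: "\<And>z. z \<in> space (zhat_space P N) \<Longrightarrow> D z \<le> C"
    and D_step: "\<And>\<pi> w v. (\<pi>, w, v) \<in> space (zhat_space P N) \<Longrightarrow>
      D (\<pi>, w, v) \<le> K * filter_mismatch P \<pi>s (\<pi>, w, v) + discount P *
        (\<Sum>y\<in>UNIV. D (next_predictor P \<pi> (hd w) (hd (v @ [a (\<pi>, w, v)])), tl (w @ [y]), tl (v @ [a (\<pi>, w, v)]))
           * next_obs_prob P \<pi> w v (a (\<pi>, w, v)) y)"
begin

abbreviation D_at where "D_at t z \<equiv> D (zhat_at P N \<pi>\<^sub>0 (fst (snd z)) (snd (snd z)) t)"

lemma zhat_at_space:
  assumes "length ys = Suc (t + N)" "length us = t + N"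
  shows "zhat_at P N \<pi>\<^sub>0 ys us t \<in> space (zhat_space P N)"
  using assms by (simp add: zhat_at_def zhat_space_iff predictor_beliefs prior)

text \<open>\<open>D_step\<close> is integrated over the histories. Since \<open>\<gamma>\<close>
  plays \<open>a\<close>, the sum over next observations integrates to the expected gap at time
  \<open>Suc t\<close>; since \<open>\<gamma>\<close> is admissible, the mismatch term is at most
  the L-term.\<close>

lemma nn_integral_gap_step:
  assumes \<gamma>: "\<gamma> \<in> policies P N"
    and feedback: "\<And>t ys us. length ys = Suc (t + N) \<Longrightarrow> length us = t + N \<Longrightarrow>
      action P N \<pi>\<^sub>0 \<gamma> (t + N) ys us = a (zhat_at P N \<pi>\<^sub>0 ys us t)"
  shows "(\<integral>\<^sup>+z. ennreal (D_at t z) \<partial>law P N \<pi>\<^sub>0 \<gamma> (t + N)) \<le>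
    ennreal (K * L_term P N \<pi>s \<pi>\<^sub>0 t) +
    ennreal (discount P) * (\<integral>\<^sup>+z. ennreal (D_at (Suc t) z) \<partial>law P N \<pi>\<^sub>0 \<gamma> (Suc t + N))"
proof -
  let ?law = "law P N \<pi>\<^sub>0 \<gamma> (t + N)"
  let ?next = "\<lambda>z. \<Sum>y\<in>UNIV. ennreal (next_obs_prob P \<pi>\<^sub>0 (fst (snd z)) (snd (snd z)) (act \<gamma> (t + N) (snd z)) y) *
      ennreal (D (zhat_at P N \<pi>\<^sub>0 (fst (ext \<gamma> (t + N) (snd z) y)) (snd (ext \<gamma> (t + N) (snd z) y)) (Suc t)))"
  have "(\<integral>\<^sup>+z. ennreal (D_at t z) \<partial>?law) \<le>
    (\<integral>\<^sup>+z. ennreal K * ennreal (mismatch_at \<pi>s t z) + ennreal (discount P) * ?next z \<partial>?law)"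
    using AE_law_length[where \<gamma>=\<gamma> and n="t + N"]
  proof (intro nn_integral_mono_AE, eventually_elim)
    case (elim z)
    obtain x ys us where z: "z = (x, ys, us)"
      by (metis prod_cases3)
    obtain \<pi> w v where zt: "zhat_at P N \<pi>\<^sub>0 ys us t = (\<pi>, w, v)"
      by (metis prod_cases3)
    have len: "length ys = Suc (t + N)" "length us = t + N"
      using elim by (simp_all add: z)
    have u: "action P N \<pi>\<^sub>0 \<gamma> (t + N) ys us = a (\<pi>, w, v)"
      using feedback[OF len] by (simp add: zt)
    have mem: "(\<pi>, w, v) \<in> space (zhat_space P N)"
      using zhat_at_space[OF len] by (simp add: zt)
    let ?u = "a (\<pi>, w, v)"
    let ?D = "\<lambda>y. D (zhat_at P N \<pi>\<^sub>0 (ys @ [y]) (us @ [?u]) (Suc t))"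
    have "D (\<pi>, w, v) \<le> K * filter_mismatch P \<pi>s (\<pi>, w, v) +
      discount P * (\<Sum>y\<in>UNIV. next_obs_prob P \<pi>\<^sub>0 ys us ?u y * ?D y)"
      using D_step[OF mem] by (simp add: zhat_at_snoc[OF len zt] next_obs_prob_zhat_at[OF len zt] mult.commute)
    then have "ennreal (D (\<pi>, w, v)) \<le> ennreal (K * filter_mismatch P \<pi>s (\<pi>, w, v) +
      discount P * (\<Sum>y\<in>UNIV. next_obs_prob P \<pi>\<^sub>0 ys us ?u y * ?D y))"
      by (rule ennreal_leI)
    also have "\<dots> = ennreal K * ennreal (filter_mismatch P \<pi>s (\<pi>, w, v)) +
      ennreal (discount P) * (\<Sum>y\<in>UNIV. ennreal (next_obs_prob P \<pi>\<^sub>0 ys us ?u y) * ennreal (?D y))"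
      using K D_nonneg next_obs_prob_nonneg discount_range(1) mismatch_at_range(1)[OF \<pi>s, where t=t and z=z]
      by (intro ennreal_affine_sum) (simp_all add: z zt less_imp_le)
    finally show ?case
      by (simp add: z zt u)
  qed
  also have "\<dots> = ennreal K * (\<integral>\<^sup>+z. ennreal (mismatch_at \<pi>s t z) \<partial>?law) +
    ennreal (discount P) * (\<integral>\<^sup>+z. ?next z \<partial>?law)"
  proof -
    have [measurable]: "(\<lambda>z. ennreal (mismatch_at \<pi>s t z)) \<in> borel_measurable Q" "?next \<in> borel_measurable Q"
      by (rule history_measurable, simp)+
    show ?thesis
      by (simp add: nn_integral_add nn_integral_cmult del: fst_conv snd_conv)
  qed
  also have "(\<integral>\<^sup>+z. ?next z \<partial>?law) = (\<integral>\<^sup>+z. ennreal (D_at (Suc t) z) \<partial>law P N \<pi>\<^sub>0 \<gamma> (Suc t + N))"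
    using nn_integral_law_history_Suc[where \<gamma>=\<gamma> and n="t + N"
        and G="\<lambda>h. ennreal (D (zhat_at P N \<pi>\<^sub>0 (fst h) (snd h) (Suc t)))"]
    by (simp del: law.simps)
  also have "ennreal K * (\<integral>\<^sup>+z. ennreal (mismatch_at \<pi>s t z) \<partial>?law) \<le> ennreal (K * L_term P N \<pi>s \<pi>\<^sub>0 t)"
    using K L_term_range[OF \<pi>s]
    by (simp add: ennreal_mult mult_left_mono nn_integral_mismatch_le_L_term[OF \<pi>s \<gamma>])
  finally show ?thesis
    by (simp add: add_right_mono del: law.simps)
qed

text \<open>Induction on the horizon \<open>T\<close> with the starting time arbitrary, because the
  hypothesis is used at \<open>Suc t\<close>. At the horizon the gap is replaced by
  \<open>C\<close>.\<close>

lemma nn_integral_gap_iterate: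
  assumes \<gamma>: "\<gamma> \<in> policies P N"
    and feedback: "\<And>t ys us. length ys = Suc (t + N) \<Longrightarrow> length us = t + N \<Longrightarrow>
      action P N \<pi>\<^sub>0 \<gamma> (t + N) ys us = a (zhat_at P N \<pi>\<^sub>0 ys us t)"
    and C: "0 \<le> C"
  shows "(\<integral>\<^sup>+z. ennreal (D_at t z) \<partial>law P N \<pi>\<^sub>0 \<gamma> (t + N)) \<le>
    ennreal (K * (\<Sum>s<T. discount P ^ s * L_term P N \<pi>s \<pi>\<^sub>0 (t + s)) + discount P ^ T * C)"
proof (induction T arbitrary: t)
  case 0
  interpret prob_space "law P N \<pi>\<^sub>0 \<gamma> (t + N)"
    by (rule prob_space_law)
  have "(\<integral>\<^sup>+z. ennreal (D_at t z) \<partial>law P N \<pi>\<^sub>0 \<gamma> (t + N)) \<le> (\<integral>\<^sup>+z. ennreal C \<partial>law P N \<pi>\<^sub>0 \<gamma> (t + N))"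
    using AE_law_length[where \<gamma>=\<gamma> and n="t + N"]
    by (intro nn_integral_mono_AE, eventually_elim) (intro ennreal_leI D_bounded zhat_at_space; simp)
  then show ?case
    by (simp add: emeasure_space_1 del: law.simps)
next
  case (Suc T)
  let ?L = "L_term P N \<pi>s \<pi>\<^sub>0"
  define X where "X = K * (\<Sum>s<T. discount P ^ s * ?L (Suc t + s)) + discount P ^ T * C"
  have X: "0 \<le> X"
    unfolding X_def using K C discount_range L_term_range[OF \<pi>s]
    by (intro add_nonneg_nonneg mult_nonneg_nonneg sum_nonneg) auto
  have "(\<integral>\<^sup>+z. ennreal (D_at t z) \<partial>law P N \<pi>\<^sub>0 \<gamma> (t + N)) \<le> ennreal (K * ?L t) +
    ennreal (discount P) * (\<integral>\<^sup>+z. ennreal (D_at (Suc t) z) \<partial>law P N \<pi>\<^sub>0 \<gamma> (Suc t + N))"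
    by (rule nn_integral_gap_step[OF \<gamma> feedback])
  also have "\<dots> \<le> ennreal (K * ?L t) + ennreal (discount P) * ennreal X"
    unfolding X_def by (intro add_left_mono mult_left_mono Suc.IH zero_le)
  also have "\<dots> = ennreal (K * ?L t + discount P * X)"
    using K X discount_range(1) L_term_range(1)[OF \<pi>s, of t] by (simp add: ennreal_mult)
  also have "K * ?L t + discount P * X =
    K * (\<Sum>s<Suc T. discount P ^ s * ?L (t + s)) + discount P ^ Suc T * C"
    unfolding X_def sum.lessThan_Suc_shift by (simp add: distrib_left sum_distrib_left mult_ac)
  finally show ?case .
qed

end

lemma summable_discounted_L_term:
  assumes "\<pi>s \<in> beliefs P"
  shows "summable (\<lambda>t. discount P ^ t * L_term P N \<pi>s \<pi>\<^sub>0 t)"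
proof (rule summable_comparison_test')
  show "summable (\<lambda>t. discount P ^ t * 2)"
    using discount_range by (intro summable_mult2 summable_geometric) simp
  show "norm (discount P ^ t * L_term P N \<pi>s \<pi>\<^sub>0 t) \<le> discount P ^ t * 2" if "0 \<le> t" for t
    using discount_range(1) L_term_range[OF assms, of t] by (simp add: abs_mult)
qed

end

section \<open>Comparison with the approximate model\<close>

context pomdp_model
begin

lemma cost_measurable [measurable]: "(\<lambda>x. cost P x u) \<in> borel_measurable S"
proof -
  have "(\<lambda>(x, u). cost P x u) \<in> borel_measurable (S \<Otimes>\<^sub>M count_space UNIV)"
    using valid by (simp add: valid_pomdp_def)
  from measurable_compose[OF measurable_Pair2'[of u "count_space UNIV" S] this] show ?thesis
    by simp
qed

lemma states_nonempty: "states P \<noteq> {}"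
proof -
  have "null_posterior P \<in> beliefs P"
    using valid by (simp add: valid_pomdp_def)
  from prob_space.not_empty[OF beliefsD(1)[OF this]] beliefsD(3)[OF this] show ?thesis
    by (simp add: space_state_space)
qed

lemma abs_cost_le: "x \<in> space S \<Longrightarrow> \<bar>cost P x u\<bar> \<le> cost_norm P"
proof -
  assume x: "x \<in> space S"
  obtain C where "\<forall>x\<in>states P. \<forall>u. \<bar>cost P x u\<bar> \<le> C"
    using valid by (auto simp: valid_pomdp_def)
  then have "bdd_above ((\<lambda>(x, u). \<bar>cost P x u\<bar>) ` (states P \<times> UNIV))"
    by (intro bdd_aboveI2[where M=C]) auto
  from cSUP_upper[OF _ this, of "(x, u)"] x show ?thesis
    by (simp add: cost_norm_def space_state_space)
qed

lemma cost_norm_nonneg: "0 \<le> cost_norm P"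
  using states_nonempty abs_cost_le by (metis abs_ge_zero all_not_in_conv order_trans space_state_space)

text \<open>Integrated against the posterior, this gives the right-hand side of a Bellman equation
  whose continuation value after observation \<open>y\<close> is \<open>g y\<close>. Changing the
  prior then changes only the measure against which one bounded function is integrated.\<close>

definition stage_payoff where
  "stage_payoff u g x = cost P x u + discount P * (\<Sum>y\<in>UNIV. g y * obs_mass (transition P x u) y)"

lemma stage_payoff_measurable: "stage_payoff u g \<in> borel_measurable S"
  unfolding stage_payoff_def[abs_def] by measurable

lemma abs_stage_payoff_le:
  assumes x: "x \<in> space S" and g: "\<And>y. \<bar>g y\<bar> \<le> B"
  shows "\<bar>stage_payoff u g x\<bar> \<le> cost_norm P + discount P * B"
proof -
  have "\<bar>\<Sum>y\<in>UNIV. g y * obs_mass (transition P x u) y\<bar> \<le> (\<Sum>y\<in>UNIV. B * obs_mass (transition P x u) y)"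
    by (intro order.trans[OF sum_abs] sum_mono) (simp add: abs_mult mult_right_mono g)
  also have "\<dots> = B"
    using sum_obs_mass[OF transition_beliefs[OF x]] by (simp flip: sum_distrib_left)
  finally have "\<bar>discount P * (\<Sum>y\<in>UNIV. g y * obs_mass (transition P x u) y)\<bar> \<le> discount P * B"
    using discount_range by (simp add: abs_mult)
  then show ?thesis
    unfolding stage_payoff_def using abs_cost_le[OF x, of u] by linarith
qed

lemma integral_stage_payoff:
  assumes \<pi>: "\<pi> \<in> beliefs P"
  shows "zcost P (\<pi>, ys, us) u + discount P * (\<Sum>y\<in>UNIV. g y * next_obs_prob P \<pi> ys us u y) =
    (\<integral>x. stage_payoff u g x \<partial>posterior P \<pi> ys us)"
proof -
  note \<mu> = posterior_beliefs[OF \<pi>, of ys us]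
  have int_cost: "integrable (posterior P \<pi> ys us) (\<lambda>x. cost P x u)"
    by (rule integrable_beliefs[OF \<mu> cost_measurable abs_cost_le])
  have int_mass: "integrable (posterior P \<pi> ys us) (\<lambda>x. obs_mass (transition P x u) y)" for y
    by (rule integrable_beliefs[OF \<mu> obs_mass_transition_measurable, where B=1])
       (simp add: obs_mass_le_1 transition_beliefs)
  show ?thesis
    unfolding stage_payoff_def zcost_def next_obs_prob_def
    by (simp add: int_cost int_mass)
qed

lemma abs_zcost_plus_le:
  assumes "\<pi> \<in> beliefs P" "\<And>y. \<bar>g y\<bar> \<le> B"
  shows "\<bar>zcost P (\<pi>, ys, us) u + discount P * (\<Sum>y\<in>UNIV. g y * next_obs_prob P \<pi> ys us u y)\<bar>
    \<le> cost_norm P + discount P * B"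
  unfolding integral_stage_payoff[OF assms(1)]
  by (rule abs_integral_beliefs_le[OF posterior_beliefs[OF assms(1)] stage_payoff_measurable
        abs_stage_payoff_le[OF _ assms(2)]])

text \<open>Both terms are integrals of the same \<open>stage_payoff\<close>, so the total variation
  of the two posteriors controls the difference.\<close>

lemma prior_change_le:
  assumes \<pi>: "\<pi> \<in> beliefs P" and \<pi>s: "\<pi>s \<in> beliefs P" and g: "\<And>y. \<bar>g y\<bar> \<le> B"
  shows "\<bar>(zcost P (\<pi>, ys, us) u + discount P * (\<Sum>y\<in>UNIV. g y * next_obs_prob P \<pi> ys us u y)) -
      (zcost P (\<pi>s, ys, us) u + discount P * (\<Sum>y\<in>UNIV. g y * next_obs_prob P \<pi>s ys us u y))\<bar>
    \<le> (cost_norm P + discount P * B) * filter_mismatch P \<pi>s (\<pi>, ys, us)"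
proof -
  have "0 \<le> B"
    using g[of undefined] by linarith
  then have "0 \<le> cost_norm P + discount P * B"
    using cost_norm_nonneg discount_range by simp
  with posterior_beliefs[OF \<pi>] posterior_beliefs[OF \<pi>s] show ?thesis
    unfolding integral_stage_payoff[OF \<pi>] integral_stage_payoff[OF \<pi>s] filter_mismatch_def prod.case
    by (intro abs_integral_diff_le_tv_dist stage_payoff_measurable abs_stage_payoff_le g)
       (simp_all add: beliefs_def)
qed

lemma approx_states_snoc:
  assumes "(\<pi>, ys, us) \<in> approx_states N \<pi>s"
  shows "(\<pi>, tl (ys @ [y]), tl (us @ [u])) \<in> approx_states N \<pi>s"
  using assms by (auto simp: approx_states_def)

text \<open>On the finite state set the maximum \<open>B\<close> of the absolute value is attained,
  and the fixed-point equation at that state gives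
  \<open>B \<le> cost_norm P + discount P * B\<close>.\<close>

lemma approx_value_bound:
  assumes \<pi>s: "\<pi>s \<in> beliefs P" and J: "approx_value P N \<pi>s J" and z: "z \<in> approx_states N \<pi>s"
  shows "\<bar>J z\<bar> \<le> cost_norm P / (1 - discount P)"
proof -
  let ?A = "approx_states N \<pi>s :: ('x, 'y, 'u) zhat set"
  have fin: "finite ?A"
    unfolding approx_states_def
    by (intro finite_cartesian_product finite_lists_length finite.intros)
  define B where "B = Max ((\<lambda>z. \<bar>J z\<bar>) ` ?A)"
  have B: "\<bar>J z\<bar> \<le> B" if "z \<in> ?A" for z
    unfolding B_def using fin that by auto
  have "B \<in> (\<lambda>z. \<bar>J z\<bar>) ` ?A"
    unfolding B_def using fin z by (intro Max_in) auto
  then obtain z' where z': "z' \<in> ?A" "B = \<bar>J z'\<bar>"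
    by blast
  have "J z' = (MIN u. approx_bellman P J z' u)"
    using J z'(1) by (simp add: approx_value_def)
  then have "J z' \<in> range (approx_bellman P J z')"
    using Min_in[of "range (approx_bellman P J z')"] by simp
  then obtain u where u: "J z' = approx_bellman P J z' u"
    by blast
  obtain ys us where z'_eq: "z' = (\<pi>s, ys, us)"
    using z'(1) by (auto simp: approx_states_def)
  have "\<bar>J (\<pi>s, tl (ys @ [y]), tl (us @ [u]))\<bar> \<le> B" for y
    using z'(1) unfolding z'_eq by (intro B approx_states_snoc)
  then have "\<bar>approx_bellman P J z' u\<bar> \<le> cost_norm P + discount P * B"
    unfolding z'_eq approx_bellman_def prod.case by (rule abs_zcost_plus_le[OF \<pi>s])
  then have "B \<le> cost_norm P + discount P * B"
    using u z'(2) by simp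
  then have "B \<le> cost_norm P / (1 - discount P)"
    using discount_range by (simp add: field_simps)
  then show ?thesis
    using B[OF z] by linarith
qed

text \<open>The intermediate term keeps the true prior \<open>\<pi>\<close> but uses the
  continuation values of \<open>JN\<close>. One difference is then a pure change of prior, the other
  a pure change of continuation under the true observation law.\<close>

lemma bellman_gap:
  assumes \<pi>: "\<pi> \<in> beliefs P" and \<pi>s: "\<pi>s \<in> beliefs P" and JN: "approx_value P N \<pi>s JN"
    and len: "length ys = Suc N" "length us = N"
  shows "\<bar>bellman P J (\<pi>, ys, us) u - approx_bellman P JN (\<pi>s, ys, us) u\<bar> \<le>
    cost_norm P / (1 - discount P) * filter_mismatch P \<pi>s (\<pi>, ys, us) +
    discount P * (\<Sum>y\<in>UNIV.
      \<bar>J (next_predictor P \<pi> (hd ys) (hd (us @ [u])), tl (ys @ [y]), tl (us @ [u])) -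
       JN (\<pi>s, tl (ys @ [y]), tl (us @ [u]))\<bar> * next_obs_prob P \<pi> ys us u y)"
proof -
  define B where "B = cost_norm P / (1 - discount P)"
  define g where "g y = JN (\<pi>s, tl (ys @ [y]), tl (us @ [u]))" for y
  define f where "f y = J (next_predictor P \<pi> (hd ys) (hd (us @ [u])), tl (ys @ [y]), tl (us @ [u]))" for y
  define q where "q = next_obs_prob P \<pi> ys us u"
  have g: "\<bar>g y\<bar> \<le> B" for y
    unfolding g_def B_def using len
    by (intro approx_value_bound[OF \<pi>s JN]) (simp add: approx_states_def)
  \<comment> \<open>\<open>B\<close> is the fixed point of this affine map, so the constant from
    \<open>prior_change_le\<close> is \<open>B\<close> again.\<close>
  have B: "cost_norm P + discount P * B = B"
    using discount_range by (simp add: B_def field_simps)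
  have "\<bar>\<Sum>y\<in>UNIV. (f y - g y) * q y\<bar> \<le> (\<Sum>y\<in>UNIV. \<bar>f y - g y\<bar> * q y)"
    using next_obs_prob_nonneg by (intro order.trans[OF sum_abs]) (simp add: abs_mult q_def)
  then have "\<bar>discount P * (\<Sum>y\<in>UNIV. (f y - g y) * q y)\<bar> \<le> discount P * (\<Sum>y\<in>UNIV. \<bar>f y - g y\<bar> * q y)"
    using discount_range by (simp add: abs_mult)
  moreover have "\<bar>(zcost P (\<pi>, ys, us) u + discount P * (\<Sum>y\<in>UNIV. g y * q y)) -
      (zcost P (\<pi>s, ys, us) u + discount P * (\<Sum>y\<in>UNIV. g y * next_obs_prob P \<pi>s ys us u y))\<bar>
    \<le> B * filter_mismatch P \<pi>s (\<pi>, ys, us)"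
    using prior_change_le[OF \<pi> \<pi>s g, of ys us u] by (simp only: B q_def)
  moreover have "bellman P J (\<pi>, ys, us) u - approx_bellman P JN (\<pi>s, ys, us) u =
      (zcost P (\<pi>, ys, us) u + discount P * (\<Sum>y\<in>UNIV. g y * q y)) -
      (zcost P (\<pi>s, ys, us) u + discount P * (\<Sum>y\<in>UNIV. g y * next_obs_prob P \<pi>s ys us u y)) +
      discount P * (\<Sum>y\<in>UNIV. (f y - g y) * q y)"
    unfolding bellman_def approx_bellman_def prod.case f_def g_def q_def
    by (simp add: left_diff_distrib sum_subtractf right_diff_distrib)
  ultimately have "\<bar>bellman P J (\<pi>, ys, us) u - approx_bellman P JN (\<pi>s, ys, us) u\<bar> \<le>
    B * filter_mismatch P \<pi>s (\<pi>, ys, us) + discount P * (\<Sum>y\<in>UNIV. \<bar>f y - g y\<bar> * q y)"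
    by linarith
  then show ?thesis
    by (simp only: B_def f_def g_def q_def)
qed

end

context controlled_pomdp
begin

text \<open>Serves both comparisons with \<open>JN\<close>: \<open>gap\<close> asks for just one
  action at which the difference of Bellman right-hand sides dominates the difference of
  values.\<close>

lemma value_gap:
  fixes J JN :: "('x, 'y, 'u) zhat \<Rightarrow> real"
  assumes \<pi>s: "\<pi>s \<in> beliefs P" and JN: "approx_value P N \<pi>s JN" and J: "bounded_on_zhat P N J"
    and \<gamma>: "\<gamma> \<in> policies P N"
    and gap: "\<And>\<pi> ys us. (\<pi>, ys, us) \<in> space (zhat_space P N) \<Longrightarrow> \<exists>u.
      \<bar>J (\<pi>, ys, us) - JN (\<pi>s, ys, us)\<bar> \<le> \<bar>bellman P J (\<pi>, ys, us) u - approx_bellman P JN (\<pi>s, ys, us) u\<bar>"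
  shows "(\<integral>\<^sup>+z. ennreal \<bar>J (\<pi>\<^sub>0, snd z) - JN (\<pi>s, snd z)\<bar> \<partial>law P N \<pi>\<^sub>0 \<gamma> N) \<le>
    ennreal (cost_norm P / (1 - discount P) * (\<Sum>t. discount P ^ t * L_term P N \<pi>s \<pi>\<^sub>0 t))"
proof -
  define D where "D z = \<bar>J z - JN (\<pi>s, snd z)\<bar>" for z
  define K where "K = cost_norm P / (1 - discount P)"
  have K: "0 \<le> K"
    using cost_norm_nonneg discount_range by (simp add: K_def)
  obtain C where C: "\<And>z. z \<in> space (zhat_space P N) \<Longrightarrow> \<bar>J z\<bar> \<le> C"
    using J by (auto simp: bounded_on_zhat_def)
  have D_bounded: "D z \<le> \<bar>C\<bar> + K" if "z \<in> space (zhat_space P N)" for z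
  proof -
    have "(\<pi>s, snd z) \<in> approx_states N \<pi>s"
      using that by (cases z) (auto simp: zhat_space_iff approx_states_def)
    then show ?thesis
      using approx_value_bound[OF \<pi>s JN] C[OF that] unfolding D_def K_def by fastforce
  qed
  have "\<forall>z. \<exists>u. z \<in> space (zhat_space P N) \<longrightarrow>
      D z \<le> \<bar>bellman P J z u - approx_bellman P JN (\<pi>s, snd z) u\<bar>"
    unfolding D_def using gap by (metis prod.collapse)
  then obtain a where a: "\<And>z. z \<in> space (zhat_space P N) \<Longrightarrow>
      D z \<le> \<bar>bellman P J z (a z) - approx_bellman P JN (\<pi>s, snd z) (a z)\<bar>"
    by metis
  have D_step: "D (\<pi>, w, v) \<le> K * filter_mismatch P \<pi>s (\<pi>, w, v) + discount P *
        (\<Sum>y\<in>UNIV. D (next_predictor P \<pi> (hd w) (hd (v @ [a (\<pi>, w, v)])), tl (w @ [y]), tl (v @ [a (\<pi>, w, v)]))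
           * next_obs_prob P \<pi> w v (a (\<pi>, w, v)) y)"
    if "(\<pi>, w, v) \<in> space (zhat_space P N)" for \<pi> w v
    using a[OF that] bellman_gap[OF _ \<pi>s JN, of \<pi> w v J "a (\<pi>, w, v)"] that
    unfolding zhat_space_iff K_def by (simp add: D_def)
  \<comment> \<open>\<open>\<gamma>'\<close> copies \<open>\<gamma>\<close> on the initial window
    and afterwards plays the dominating actions \<open>a\<close>.\<close>
  obtain \<gamma>' where \<gamma>': "\<gamma>' \<in> policies P N" "fst \<gamma>' = fst \<gamma>"
    "\<And>t ys us. length ys = Suc (t + N) \<Longrightarrow> length us = t + N \<Longrightarrow>
       action P N \<pi>\<^sub>0 \<gamma>' (t + N) ys us = a (zhat_at P N \<pi>\<^sub>0 ys us t)"
    using exists_feedback_policy[where a=a and f="fst \<gamma>"] by metis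
  let ?E = "\<integral>\<^sup>+z. ennreal (D (zhat_at P N \<pi>\<^sub>0 (fst (snd z)) (snd (snd z)) 0)) \<partial>law P N \<pi>\<^sub>0 \<gamma>' (0 + N)"
  let ?S = "\<lambda>T. K * (\<Sum>s<T. discount P ^ s * L_term P N \<pi>s \<pi>\<^sub>0 s) + discount P ^ T * (\<bar>C\<bar> + K)"
  have "?E \<le> ennreal (?S T)" for T
    using nn_integral_gap_iterate[where D=D and a=a and K=K and C="\<bar>C\<bar> + K" and t=0 and T=T,
        OF \<pi>s K _ D_bounded D_step \<gamma>'(1,3)] K
    by (simp add: D_def)
  \<comment> \<open>As the horizon grows, the contribution of the crude bound vanishes
    geometrically.\<close>
  moreover have "?S \<longlonglongrightarrow> K * (\<Sum>t. discount P ^ t * L_term P N \<pi>s \<pi>\<^sub>0 t) + 0 * (\<bar>C\<bar> + K)"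
    using discount_range
    by (intro tendsto_intros summable_LIMSEQ summable_discounted_L_term \<pi>s) auto
  ultimately have "?E \<le> ennreal (K * (\<Sum>t. discount P ^ t * L_term P N \<pi>s \<pi>\<^sub>0 t))"
    by (intro LIMSEQ_le_const[OF tendsto_ennrealI]) auto
  \<comment> \<open>At time 0 the predictor is the prior, and the truncations in
    \<open>zhat_at\<close> do nothing to lists of the almost sure lengths.\<close>
  moreover have "?E = (\<integral>\<^sup>+z. ennreal \<bar>J (\<pi>\<^sub>0, snd z) - JN (\<pi>s, snd z)\<bar> \<partial>law P N \<pi>\<^sub>0 \<gamma>' N)"
    using AE_law_length[where \<gamma>=\<gamma>' and n=N]
    by (simp, intro nn_integral_cong_AE, eventually_elim) (simp add: D_def zhat_at_def)
  ultimately show ?thesis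
    using law_cong_initial[OF \<gamma>'(2), of N] by (simp add: K_def)
qed

end

theorem theorem3p3:
  fixes P :: "(real ^ 'm, 'y::finite, 'u::finite) pomdp"
    and N :: nat
    and \<pi>s \<pi>\<^sub>0 :: "(real ^ 'm) measure"
    and Jopt JN J\<phi> :: "(real ^ 'm, 'y, 'u) zhat \<Rightarrow> real"
    and \<phi>N :: "(real ^ 'm, 'y, 'u) zhat \<Rightarrow> 'u"
    and \<gamma> :: "(real ^ 'm, 'y, 'u) policy"
  assumes "valid_pomdp P"
    and "\<pi>s \<in> beliefs P"
    and "\<pi>\<^sub>0 \<in> beliefs P"
    and "optimal_value P N Jopt"
    and "approx_value P N \<pi>s JN"
    and "approx_optimal_policy P N \<pi>s JN \<phi>N"
    and "policy_value P N (extend_policy \<pi>s \<phi>N) J\<phi>"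
    and "\<gamma> \<in> policies P N"
  shows "(\<integral>(x, ys, us). \<bar>J\<phi> (\<pi>\<^sub>0, ys, us) - Jopt (\<pi>\<^sub>0, ys, us)\<bar> \<partial>law P N \<pi>\<^sub>0 \<gamma> N)
       \<le> 2 * cost_norm P / (1 - discount P) * (\<Sum>t. discount P ^ t * L_term P N \<pi>s \<pi>\<^sub>0 t)"
proof -
  interpret controlled_pomdp P N \<pi>\<^sub>0
    using assms(1,3) by unfold_locales
  let ?law = "law P N \<pi>\<^sub>0 \<gamma> N"
  define R where "R = cost_norm P / (1 - discount P) * (\<Sum>t. discount P ^ t * L_term P N \<pi>s \<pi>\<^sub>0 t)"
  \<comment> \<open>\<open>ennreal\<close> sends negative reals to zero, so the sign is needed to
    add the two bounds and return to the reals.\<close>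
  have R: "0 \<le> R"
    unfolding R_def using cost_norm_nonneg discount_range L_term_range[OF assms(2)]
    by (intro mult_nonneg_nonneg suminf_nonneg summable_discounted_L_term assms(2)) auto
  have states: "(\<pi>s, ys, us) \<in> approx_states N \<pi>s" if "(\<pi>, ys, us) \<in> space (zhat_space P N)" for \<pi> ys us
    using that by (simp add: zhat_space_iff approx_states_def)
  have JN_eq: "JN z = (MIN u. approx_bellman P JN z u)" if "z \<in> approx_states N \<pi>s" for z
    using assms(5) that by (simp add: approx_value_def)
  have opt: "(\<integral>\<^sup>+z. ennreal \<bar>Jopt (\<pi>\<^sub>0, snd z) - JN (\<pi>s, snd z)\<bar> \<partial>?law) \<le> ennreal R"
    unfolding R_def
  proof (rule value_gap[OF assms(2,5) _ assms(8)])
    fix \<pi> ys us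
    assume z: "(\<pi>, ys, us) \<in> space (zhat_space P N)"
    have "Jopt (\<pi>, ys, us) = (MIN u. bellman P Jopt (\<pi>, ys, us) u)"
      using assms(4) z by (simp add: optimal_value_def)
    then show "\<exists>u. \<bar>Jopt (\<pi>, ys, us) - JN (\<pi>s, ys, us)\<bar> \<le>
        \<bar>bellman P Jopt (\<pi>, ys, us) u - approx_bellman P JN (\<pi>s, ys, us) u\<bar>"
      unfolding JN_eq[OF states[OF z]] by (simp only: exists_abs_Min_diff_le)
  qed (use assms(4) in \<open>simp add: optimal_value_def\<close>)
  \<comment> \<open>The required action is the one chosen by \<open>\<phi>N\<close> at the window:
    the extended policy plays it under every belief, and it attains the minimum defining
    \<open>JN\<close>, so the two differences coincide.\<close>
  have pol: "(\<integral>\<^sup>+z. ennreal \<bar>J\<phi> (\<pi>\<^sub>0, snd z) - JN (\<pi>s, snd z)\<bar> \<partial>?law) \<le> ennreal R"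
    unfolding R_def
  proof (rule value_gap[OF assms(2,5) _ assms(8)])
    fix \<pi> ys us
    assume z: "(\<pi>, ys, us) \<in> space (zhat_space P N)"
    let ?u = "\<phi>N (\<pi>s, ys, us)"
    have "J\<phi> (\<pi>, ys, us) = bellman P J\<phi> (\<pi>, ys, us) ?u"
      using assms(7) z by (simp add: policy_value_def extend_policy_def)
    moreover have "JN (\<pi>s, ys, us) = approx_bellman P JN (\<pi>s, ys, us) ?u"
      using assms(6) JN_eq[OF states[OF z]] states[OF z] by (simp add: approx_optimal_policy_def)
    ultimately show "\<exists>u. \<bar>J\<phi> (\<pi>, ys, us) - JN (\<pi>s, ys, us)\<bar> \<le>
        \<bar>bellman P J\<phi> (\<pi>, ys, us) u - approx_bellman P JN (\<pi>s, ys, us) u\<bar>"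
      by (intro exI[of _ ?u]) simp
  qed (use assms(7) in \<open>simp add: policy_value_def\<close>)
  have meas: "(\<lambda>z. ennreal (f (snd z))) \<in> borel_measurable ?law" for f
    using history_measurable[of "\<lambda>h. ennreal (f h)" borel] by (simp cong: measurable_cong_sets)
  \<comment> \<open>Triangle inequality through \<open>JN\<close> at the same window.\<close>
  have "(\<integral>\<^sup>+z. ennreal \<bar>J\<phi> (\<pi>\<^sub>0, snd z) - Jopt (\<pi>\<^sub>0, snd z)\<bar> \<partial>?law) \<le>
    (\<integral>\<^sup>+z. ennreal \<bar>J\<phi> (\<pi>\<^sub>0, snd z) - JN (\<pi>s, snd z)\<bar> + ennreal \<bar>Jopt (\<pi>\<^sub>0, snd z) - JN (\<pi>s, snd z)\<bar> \<partial>?law)"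
    by (intro nn_integral_mono) (simp add: ennreal_leI flip: ennreal_plus)
  also have "\<dots> = (\<integral>\<^sup>+z. ennreal \<bar>J\<phi> (\<pi>\<^sub>0, snd z) - JN (\<pi>s, snd z)\<bar> \<partial>?law) +
    (\<integral>\<^sup>+z. ennreal \<bar>Jopt (\<pi>\<^sub>0, snd z) - JN (\<pi>s, snd z)\<bar> \<partial>?law)"
    by (rule nn_integral_add) (rule meas)+
  also have "\<dots> \<le> ennreal R + ennreal R"
    by (rule add_mono[OF pol opt])
  also have "\<dots> = ennreal (2 * R)"
    using R by (simp flip: ennreal_plus)
  finally have "(\<integral>z. \<bar>J\<phi> (\<pi>\<^sub>0, snd z) - Jopt (\<pi>\<^sub>0, snd z)\<bar> \<partial>?law) \<le> 2 * R"
    using R by (intro integral_real_bounded) auto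
  then show ?thesis
    by (simp add: case_prod_beta' R_def)
qed

end
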